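(* Let $k,l,m,n$ be integers such that $n=k(m-l)+l$, where $k\geq 1$, $m\geq 2$, $\lceil \frac{m}{2}\rceil\leq l<m$ and $m\equiv 0\pmod{m-l}$. Let $K$ be a field, $R=K[x_1,\dots,x_n]$, and let $I_{m,l,k}=(u_1,\dots,u_k)\subseteq R$ with $u_i=\prod_{j=1}^{m}x_{(i-1)(m-l)+j}$ for $1\leq i\leq k$. Then $$\mathrm{depth}(I_{m,l,k})=n+2-\left\lceil \frac{n+(m-l)}{2m-l}\right\rceil-\left\lfloor \frac{n+(m-l)}{2m-l}\right\rfloor.$$
   Context: $R$ is graded in the standard way ($\deg x_i=1$); $\lceil a\rceil$ denotes the smallest integer $\ge a$ and $\lfloor a\rfloor$ the largest integer $\le a$. Here $\mathrm{depth}(I)$ denotes the depth of the ideal $I$ viewed as a graded $R$-module (with respect to the homogeneous maximal ideal $(x_1,\dots,x_n)$), not the depth of $R/I$. *)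

theory Defs
  imports
    Complex_Main
    "HOL-Library.Poly_Mapping"
    "HOL-Library.Extended_Nat"
    "HOL-Algebra.Ideal"
    "HOL-Algebra.Module"
begin

text \<open>
  A polynomial is a finitely supported function from monomials to coefficients, a monomial being
  a finitely supported function from variable indices to exponents. The type has variables
  $x_0, x_1, \dots$; the ring $K[x_1,\dots,x_n]$ is cut out as a subring.
\<close>

type_synonym 'a mpoly = "(nat \<Rightarrow>\<^sub>0 nat) \<Rightarrow>\<^sub>0 'a"

definition Var :: "nat \<Rightarrow> 'a::field mpoly" where
  "Var i = Poly_Mapping.single (Poly_Mapping.single i 1) 1"

definition mpoly_ring :: "nat \<Rightarrow> 'a::field mpoly ring" where
  "mpoly_ring n =
    \<lparr>carrier = {p. \<forall>t \<in> Poly_Mapping.keys p. Poly_Mapping.keys t \<subseteq> {1..n}},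
     mult = (*), one = 1, zero = 0, add = (+)\<rparr>"

definition irrelevant_ideal :: "nat \<Rightarrow> 'a::field mpoly set" where
  "irrelevant_ideal n = genideal (mpoly_ring n) (Var ` {1..n})"

lemma cring_mpoly_ring: "cring (mpoly_ring n :: 'a::field mpoly ring)"
proof -
  define C where "C = {p :: 'a mpoly. \<forall>t \<in> Poly_Mapping.keys p. Poly_Mapping.keys t \<subseteq> {1..n}}"
  have R: "mpoly_ring n = \<lparr>carrier = C, mult = (*), one = 1, zero = 0, add = (+)\<rparr>"
    by (simp add: mpoly_ring_def C_def)
  have zero: "0 \<in> C" and one: "1 \<in> C"
    by (simp_all add: C_def)
  have add: "p + q \<in> C" if "p \<in> C" "q \<in> C" for p q
    using that Poly_Mapping.keys_add[of p q] unfolding C_def by blast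
  have uminus: "- p \<in> C" if "p \<in> C" for p
    using that by (simp add: C_def keys.rep_eq)
  have mult: "p * q \<in> C" if pq: "p \<in> C" "q \<in> C" for p q
  proof -
    have "Poly_Mapping.keys t \<subseteq> {1..n}" if t: "t \<in> Poly_Mapping.keys (p * q)" for t
    proof -
      obtain a b where "t = a + b" "a \<in> Poly_Mapping.keys p" "b \<in> Poly_Mapping.keys q"
        using t keys_mult[of p q] by blast
      then show ?thesis
        using pq Poly_Mapping.keys_add[of a b] unfolding C_def by blast
    qed
    then show ?thesis unfolding C_def by blast
  qed
  show ?thesis
    unfolding R
  proof (rule cringI)
    show "abelian_group \<lparr>carrier = C, mult = (*), one = 1, zero = 0, add = (+)\<rparr>"
      by (rule abelian_groupI) (auto simp: add zero add_ac intro: bexI[OF _ uminus])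
    show "comm_monoid \<lparr>carrier = C, mult = (*), one = 1, zero = 0, add = (+)\<rparr>"
      by (rule comm_monoidI) (auto simp: mult one mult_ac)
  qed (auto simp: distrib_right)
qed

lemma Var_in_mpoly_ring: "i \<in> {1..n} \<Longrightarrow> Var i \<in> carrier (mpoly_ring n)"
  by (auto simp: Var_def mpoly_ring_def)

definition ideal_module :: "('a, 'm) ring_scheme \<Rightarrow> 'a set \<Rightarrow> ('a, 'a) module" where
  "ideal_module R I =
    \<lparr>carrier = I, mult = mult R, one = one R, zero = zero R, add = add R, smult = mult R\<rparr>"

lemma (in cring) module_ideal_module:
  assumes "ideal I R"
  shows "module R (ideal_module R I)"
proof -
  interpret I: ideal I R by fact
  show ?thesis
  proof (rule moduleI)
    show "abelian_group (ideal_module R I)"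
    proof (rule abelian_groupI)
      fix x assume "x \<in> carrier (ideal_module R I)"
      then show "\<exists>y\<in>carrier (ideal_module R I).
          y \<oplus>\<^bsub>ideal_module R I\<^esub> x = \<zero>\<^bsub>ideal_module R I\<^esub>"
        by (intro bexI[of _ "\<ominus> x"]) (auto simp: ideal_module_def l_neg I.Icarr)
    qed (auto simp: ideal_module_def I.Icarr a_ac)
  qed (auto simp: ideal_module_def I.Icarr I.I_l_closed l_distr r_distr m_assoc is_cring)
qed

text \<open>The submodule $(f_1,\dots,f_r)M$ of $M$; for $r = 0$ it is the zero submodule.\<close>

definition seq_submodule ::
  "('a, 'm) ring_scheme \<Rightarrow> ('a, 'b, 'n) module_scheme \<Rightarrow> 'a list \<Rightarrow> 'b set" where
  "seq_submodule R M fs =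
    {(\<Oplus>\<^bsub>M\<^esub>i\<in>{..<length fs}. (fs ! i) \<odot>\<^bsub>M\<^esub> v i) | v. v \<in> {..<length fs} \<rightarrow> carrier M}"

text \<open>
  $f_1,\dots,f_r$ is $M$-regular if each $f_i$ is a non-zero-divisor on
  $M/(f_1,\dots,f_{i-1})M$, and $M \neq (f_1,\dots,f_r)M$. The first condition is written
  without the quotient module.
\<close>

definition regular_sequence ::
  "('a, 'm) ring_scheme \<Rightarrow> ('a, 'b, 'n) module_scheme \<Rightarrow> 'a list \<Rightarrow> bool" where
  "regular_sequence R M fs \<longleftrightarrow>
    set fs \<subseteq> carrier R \<and>
    (\<forall>i<length fs. \<forall>x\<in>carrier M.
       (fs ! i) \<odot>\<^bsub>M\<^esub> x \<in> seq_submodule R M (take i fs) \<longrightarrow> x \<in> seq_submodule R M (take i fs)) \<and>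
    seq_submodule R M fs \<noteq> carrier M"

text \<open>
  The depth of $M$ with respect to the ideal $J$: the supremum of the lengths of the $M$-regular
  sequences in $J$. For $M = 0$ no sequence is regular and the value is $0$, not $\infty$.
\<close>

definition depth ::
  "('a, 'm) ring_scheme \<Rightarrow> 'a set \<Rightarrow> ('a, 'b, 'n) module_scheme \<Rightarrow> enat" where
  "depth R J M = Sup {enat (length fs) | fs. set fs \<subseteq> J \<and> regular_sequence R M fs}"

definition ideal_depth :: "nat \<Rightarrow> 'a::field mpoly set \<Rightarrow> enat" where
  "ideal_depth n I =
    depth (mpoly_ring n) (irrelevant_ideal n) (ideal_module (mpoly_ring n) I)"

definition path_monomial :: "nat \<Rightarrow> nat \<Rightarrow> nat \<Rightarrow> 'a::field mpoly" where
  "path_monomial m l i = (\<Prod>j = 1..m. Var ((i - 1) * (m - l) + j))"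

text \<open>
  The index \<open>n\<close> is the number of variables of the ambient ring. The generators lie in that ring
  when $n = k(m-l)+l$.
\<close>

definition path_ideal :: "nat \<Rightarrow> nat \<Rightarrow> nat \<Rightarrow> nat \<Rightarrow> 'a::field mpoly set" where
  "path_ideal n m l k = genideal (mpoly_ring n) (path_monomial m l ` {1..k})"

lemma path_monomial_in_mpoly_ring:
  assumes "n = k * (m - l) + l" "l \<le> m" "i \<in> {1..k}"
  shows "path_monomial m l i \<in> carrier (mpoly_ring n :: 'a::field mpoly ring)"
proof -
  interpret cring "mpoly_ring n :: 'a mpoly ring" by (rule cring_mpoly_ring)
  have bound: "(i - 1) * (m - l) + j \<in> {1..n}" if "j \<in> {1..m}" for j
  proof -
    have "(i - 1) * (m - l) + j \<le> (k - 1) * (m - l) + m"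
      using assms that by (intro add_mono mult_right_mono) auto
    also have "\<dots> = (k - 1) * (m - l) + (m - l) + l" using assms by simp
    also have "\<dots> = n" using assms by (cases k) auto
    finally show ?thesis using that by auto
  qed
  have "(\<Prod>j\<in>J. Var ((i - 1) * (m - l) + j)) \<in> carrier (mpoly_ring n :: 'a mpoly ring)"
    if "finite J" "J \<subseteq> {1..m}" for J
    using that
  proof induction
    case empty
    then show ?case using one_closed by (simp add: mpoly_ring_def)
  next
    case (insert j J)
    then show ?case
      using m_closed[OF Var_in_mpoly_ring[OF bound[of j]]] by (simp add: mpoly_ring_def)
  qed
  then show ?thesis by (simp add: path_monomial_def)
qed

end

theory Submission
  imports Defs
begin

text \<open>
  Put \<open>s = m - l\<close> and \<open>\<kappa> = \<lfloor>(n+s)/(m+s)\<rfloor> + \<lfloor>n/(m+s)\<rfloor>\<close>; the claim is that the depth is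
  \<open>n - \<kappa> + 1\<close>.

  Lower bound. If a sequence is weakly regular on \<open>R/(J:w)\<close> and on \<open>R/(J,w)\<close>, it is weakly regular
  on \<open>R/J\<close>. Splitting along suitable monomials \<open>w\<close>, one filters \<open>R/I\<close> by polynomial rings
  in at least \<open>n - \<kappa>\<close> of the variables. On each of them the elementary symmetric polynomials
  \<open>e\<^sub>d, \<dots>, e\<^sub>1\<close> in all variables, where \<open>d = n - \<kappa>\<close>, are regular: in exactly \<open>d\<close> variables \<open>e\<^sub>d\<close> is
  the product of the variables, which again allows splitting, and further variables are
  harmless by the graded Nakayama lemma. Being universal, this sequence is regular on \<open>R/I\<close>;
  it stays regular on \<open>R\<close> when a variable is appended, and the longer sequence is regular on \<open>I\<close>.

  Upper bound. If \<open>f\<close> is regular on \<open>M\<close> and lies in the ideal generated by the variables, nonvanishing of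
  the Koszul homology \<open>H\<^sub>i(M)\<close> implies that of \<open>H\<^sub>i\<^sub>+\<^sub>1(M/fM)\<close>, and \<open>H\<^sub>i = 0\<close> for \<open>i > n\<close>. So it suffices that
  \<open>H\<^sub>\<kappa>\<^sub>-\<^sub>1(I) \<noteq> 0\<close>. Divide the variables into consecutive groups of lengths \<open>m, s, m, s, \<dots>\<close>, of which
  \<open>\<kappa>\<close> are complete. A suitable set \<open>C\<close>, containing one variable of each complete group, gives a cycle
  \<open>\<partial>(\<zeta> e\<^sub>C)\<close> with coefficients in \<open>I\<close>, where \<open>\<zeta>\<close> is the product of the remaining variables
  of these groups; an explicit linear functional shows that it is not the boundary of a chain
  with coefficients in \<open>I\<close>.
\<close>

section \<open>Weakly regular sequences\<close>

definition ring_ideal :: "'r::comm_ring_1 set \<Rightarrow> bool" where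
  "ring_ideal J \<longleftrightarrow> 0 \<in> J \<and> (\<forall>x\<in>J. \<forall>y\<in>J. x + y \<in> J) \<and> (\<forall>x\<in>J. \<forall>r. r * x \<in> J)"

definition adjoin :: "'r::comm_ring_1 set \<Rightarrow> 'r \<Rightarrow> 'r set" where
  "adjoin J f = {j + f * r | j r. j \<in> J}"

definition colon :: "'r::comm_ring_1 set \<Rightarrow> 'r \<Rightarrow> 'r set" where
  "colon J f = {x. f * x \<in> J}"

definition nzd_mod :: "'r::comm_ring_1 \<Rightarrow> 'r set \<Rightarrow> bool" where
  "nzd_mod f J \<longleftrightarrow> colon J f \<subseteq> J"

text \<open>No condition that the quotient is nonzero is imposed, so every sequence is weakly
  regular on the zero ring; splittings may therefore end at the unit ideal.\<close>

fun wreg :: "'r::comm_ring_1 list \<Rightarrow> 'r set \<Rightarrow> bool" where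
  "wreg [] J \<longleftrightarrow> True"
| "wreg (f # fs) J \<longleftrightarrow> nzd_mod f J \<and> wreg fs (adjoin J f)"

lemma ring_ideal_0: "ring_ideal J \<Longrightarrow> 0 \<in> J"
  and ring_ideal_add: "ring_ideal J \<Longrightarrow> x \<in> J \<Longrightarrow> y \<in> J \<Longrightarrow> x + y \<in> J"
  and ring_ideal_mult: "ring_ideal J \<Longrightarrow> x \<in> J \<Longrightarrow> r * x \<in> J"
  by (auto simp: ring_ideal_def)

lemma ring_ideal_mult2: "ring_ideal J \<Longrightarrow> x \<in> J \<Longrightarrow> x * r \<in> J"
  using ring_ideal_mult[of J x r] by (simp add: mult.commute)

lemma ring_ideal_uminus: "ring_ideal J \<Longrightarrow> x \<in> J \<Longrightarrow> - x \<in> J"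
  using ring_ideal_mult[of J x "-1"] by simp

lemma ring_ideal_diff: "ring_ideal J \<Longrightarrow> x \<in> J \<Longrightarrow> y \<in> J \<Longrightarrow> x - y \<in> J"
  using ring_ideal_add[of J x "- y"] ring_ideal_uminus[of J y] by simp

lemma ring_ideal_diff_iff: "ring_ideal J \<Longrightarrow> y \<in> J \<Longrightarrow> x - y \<in> J \<longleftrightarrow> x \<in> J"
  using ring_ideal_diff ring_ideal_add by fastforce

lemma ring_ideal_sum: "ring_ideal J \<Longrightarrow> (\<And>i. i \<in> A \<Longrightarrow> g i \<in> J) \<Longrightarrow> sum g A \<in> J"
  by (induction A rule: infinite_finite_induct) (auto simp: ring_ideal_0 ring_ideal_add)

lemma adjoinI: "j \<in> J \<Longrightarrow> x = j + f * r \<Longrightarrow> x \<in> adjoin J f"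
  by (auto simp: adjoin_def)

lemma adjoinE:
  assumes "x \<in> adjoin J f" obtains j r where "j \<in> J" "x = j + f * r"
  using assms by (auto simp: adjoin_def)

lemma ring_ideal_adjoin:
  assumes "ring_ideal J"
  shows "ring_ideal (adjoin J f)"
  unfolding ring_ideal_def
proof (intro conjI ballI allI)
  show "0 \<in> adjoin J f"
    using adjoinI[of 0 J 0 f 0] assms by (simp add: ring_ideal_0)
next
  fix x y assume "x \<in> adjoin J f" "y \<in> adjoin J f"
  then obtain j r k q where "j \<in> J" "k \<in> J" "x = j + f * r" "y = k + f * q"
    by (auto elim!: adjoinE)
  then show "x + y \<in> adjoin J f"
    using assms by (intro adjoinI[of "j + k" J _ f "r + q"]) (auto simp: ring_ideal_add algebra_simps)
next
  fix x s assume "x \<in> adjoin J f"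
  then obtain j r where "j \<in> J" "x = j + f * r" by (auto elim!: adjoinE)
  then show "s * x \<in> adjoin J f"
    using assms by (intro adjoinI[of "s * j" J _ f "s * r"]) (auto simp: ring_ideal_mult distrib_left mult.left_commute)
qed



lemma subset_adjoin: "J \<subseteq> adjoin J f"
  using adjoinI[of _ J _ f 0] by fastforce

lemma adjoin_commute: "adjoin (adjoin J f) g = adjoin (adjoin J g) f"
proof -
  have "adjoin (adjoin J f) g \<subseteq> adjoin (adjoin J g) f" for f g :: 'a
    by (auto simp: adjoin_def) (metis add.assoc add.commute)
  then show ?thesis by blast
qed

lemma adjoin_cong_mod:
  assumes "ring_ideal J" "f - g \<in> J"
  shows "adjoin J f = adjoin J g"
proof -
  have "adjoin J f \<subseteq> adjoin J g" if "f - g \<in> J" for f g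
  proof
    fix x assume "x \<in> adjoin J f"
    then obtain j r where "j \<in> J" "x = j + f * r" by (auto elim!: adjoinE)
    then show "x \<in> adjoin J g"
      using that assms(1) ring_ideal_add[of J j "r * (f - g)"] ring_ideal_mult[of J "f - g" r]
      by (intro adjoinI[of "j + r * (f - g)" J _ g r]) (auto simp: algebra_simps)
  qed
  moreover have "g - f \<in> J" using ring_ideal_uminus[OF assms] by simp
  ultimately show ?thesis using assms(2) by blast
qed

lemma colon_cong_mod:
  assumes "ring_ideal J" "f - g \<in> J"
  shows "colon J f = colon J g"
proof -
  have "f * x \<in> J \<longleftrightarrow> g * x \<in> J" for x
    using ring_ideal_diff_iff[OF assms(1) ring_ideal_mult[OF assms, of x], of "f * x"]
    by (simp add: algebra_simps)
  then show ?thesis by (auto simp: colon_def)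
qed

text \<open>Multiplication by \<open>w\<close> gives the exact sequence 0 -> R/(J:w) -> R/J ->
  R/(J,w) -> 0. It keeps this form modulo \<open>f\<close>, because ((J,f):w) = ((J:w),f) when
  \<open>f\<close> is a nonzerodivisor on R/(J,w); so one proceeds along the sequence.\<close>

lemma wreg_split:
  assumes "ring_ideal J" "wreg fs (colon J w)" "wreg fs (adjoin J w)"
  shows "wreg fs J"
  using assms
proof (induction fs arbitrary: J)
  case (Cons f fs)
  have nzc: "x \<in> colon J w" if "f * x \<in> colon J w" for x
    using Cons.prems(2) that by (auto simp: nzd_mod_def colon_def)
  have nza: "x \<in> adjoin J w" if "f * x \<in> adjoin J w" for x
    using Cons.prems(3) that by (auto simp: nzd_mod_def colon_def)
  have "nzd_mod f J"
    unfolding nzd_mod_def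
  proof
    fix x assume "x \<in> colon J f"
    then have fx: "f * x \<in> J" by (simp add: colon_def)
    then have "x \<in> adjoin J w" using nza subset_adjoin by blast
    then obtain j r where j: "j \<in> J" "x = j + w * r" by (auto elim!: adjoinE)
    have "w * (f * r) = f * x - f * j" using j by (simp add: algebra_simps)
    then have "f * r \<in> colon J w"
      using fx j Cons.prems(1) by (simp add: colon_def ring_ideal_diff ring_ideal_mult)
    then have "r \<in> colon J w" by (rule nzc)
    then show "x \<in> J" using j Cons.prems(1) by (simp add: colon_def ring_ideal_add)
  qed
  moreover have "colon (adjoin J f) w = adjoin (colon J w) f"
  proof
    show "adjoin (colon J w) f \<subseteq> colon (adjoin J f) w"
    proof
      fix x assume "x \<in> adjoin (colon J w) f"
      then obtain j r where "w * j \<in> J" "x = j + f * r" by (auto simp: colon_def elim!: adjoinE)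
      then show "x \<in> colon (adjoin J f) w"
        unfolding colon_def
        by (auto intro!: adjoinI[of "w * j" _ _ _ "w * r"] simp: distrib_left mult.left_commute)
    qed
  next
    show "colon (adjoin J f) w \<subseteq> adjoin (colon J w) f"
    proof
      fix r assume "r \<in> colon (adjoin J f) w"
      then obtain j s where j: "j \<in> J" "w * r = j + f * s"
        by (auto simp: colon_def elim!: adjoinE)
      have "f * s = - j + w * r" using j by simp
      then have "f * s \<in> adjoin J w"
        using j Cons.prems(1) by (intro adjoinI[of "- j" _ _ w r]) (auto simp: ring_ideal_uminus)
      then have "s \<in> adjoin J w" by (rule nza)
      then obtain j' s' where j': "j' \<in> J" "s = j' + w * s'" by (auto elim!: adjoinE)
      have "w * (r - f * s') = j + f * j'" using j j' by (simp add: algebra_simps)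
      then have "r - f * s' \<in> colon J w"
        using j j' Cons.prems(1) by (simp add: colon_def ring_ideal_add ring_ideal_mult)
      then show "r \<in> adjoin (colon J w) f"
        by (intro adjoinI[of "r - f * s'" _ _ f s']) auto
    qed
  qed
  ultimately show ?case
    using Cons.prems Cons.IH[of "adjoin J f"]
    by (simp add: ring_ideal_adjoin adjoin_commute[of J f w])
qed simp

lemma wreg_UNIV: "wreg fs UNIV"
proof -
  have "adjoin UNIV f = UNIV" for f :: 'a using subset_adjoin by blast
  then show ?thesis by (induction fs) (auto simp: nzd_mod_def)
qed

lemma wreg_append: "wreg (fs @ gs) J \<longleftrightarrow> wreg fs J \<and> wreg gs (foldl adjoin J fs)"
  by (induction fs arbitrary: J) auto

text \<open>This is (fs)M when \<open>M\<close> is an ideal. The recursive form suits induction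
  along the sequence; \<open>lin_eq_sums\<close> translates it into the sums of
  \<open>seq_submodule\<close>.\<close>

fun lin :: "'r::comm_ring_1 list \<Rightarrow> 'r set \<Rightarrow> 'r set" where
  "lin [] M = {0}"
| "lin (f # fs) M = {f * a + b | a b. a \<in> M \<and> b \<in> lin fs M}"

lemma lin_ConsI: "a \<in> M \<Longrightarrow> b \<in> lin fs M \<Longrightarrow> x = f * a + b \<Longrightarrow> x \<in> lin (f # fs) M"
  by auto

lemma lin_zero: "0 \<in> M \<Longrightarrow> 0 \<in> lin fs M"
  by (induction fs) (auto intro: exI[of _ 0])

lemma lin_mono: "M \<subseteq> N \<Longrightarrow> lin fs M \<subseteq> lin fs N"
  by (induction fs) auto

lemma lin_snoc: "lin (fs @ [f]) M = {a + f * b | a b. a \<in> lin fs M \<and> b \<in> M}"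
proof (induction fs)
  case (Cons g fs)
  have "lin ((g # fs) @ [f]) M = {g * a + (c + f * b) | a b c. a \<in> M \<and> b \<in> M \<and> c \<in> lin fs M}"
    using Cons by auto
  also have "\<dots> = {g * a + c + f * b | a b c. a \<in> M \<and> b \<in> M \<and> c \<in> lin fs M}"
    by (simp add: add.assoc)
  finally show ?case by auto
qed auto

lemma lin_add:
  assumes "\<And>x y. x \<in> M \<Longrightarrow> y \<in> M \<Longrightarrow> x + y \<in> M"
  shows "x \<in> lin fs M \<Longrightarrow> y \<in> lin fs M \<Longrightarrow> x + y \<in> lin fs M"
proof (induction fs arbitrary: x y)
  case (Cons f fs)
  then obtain a b a' b' where *: "a \<in> M" "b \<in> lin fs M" "a' \<in> M" "b' \<in> lin fs M"
    "x = f * a + b" "y = f * a' + b'" by auto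
  have "x + y = f * (a + a') + (b + b')" using * by (simp add: algebra_simps)
  then show ?case using * Cons.IH assms by (intro lin_ConsI[of "a + a'" _ "b + b'"]) auto
qed auto

lemma lin_mult:
  assumes "\<And>x. x \<in> M \<Longrightarrow> r * x \<in> M"
  shows "x \<in> lin fs M \<Longrightarrow> r * x \<in> lin fs M"
proof (induction fs arbitrary: x)
  case (Cons f fs)
  then obtain a b where *: "a \<in> M" "b \<in> lin fs M" "x = f * a + b" by auto
  have "r * x = f * (r * a) + r * b" using * by (simp add: algebra_simps)
  then show ?case using * Cons.IH assms by (intro lin_ConsI[of "r * a" _ "r * b"]) auto
qed auto

lemma foldl_adjoin_eq: "foldl adjoin J fs = {j + b | j b. j \<in> J \<and> b \<in> lin fs UNIV}"
proof (induction fs arbitrary: J)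
  case (Cons f fs)
  have "foldl adjoin J (f # fs) = {(j + f * r) + b | j b r. j \<in> J \<and> b \<in> lin fs UNIV}"
    unfolding foldl_Cons Cons by (auto simp: adjoin_def)
  also have "\<dots> = {j + (f * r + b) | j b r. j \<in> J \<and> b \<in> lin fs UNIV}"
    by (simp add: add.assoc)
  finally show ?case by auto
qed auto

lemma lin_adjoin:
  assumes "x \<in> lin fs (adjoin J f)"
  shows "\<exists>c\<in>lin fs J. \<exists>d. x = c + f * d"
  using assms
proof (induction fs arbitrary: x)
  case Nil
  then show ?case by (auto intro: exI[of _ 0])
next
  case (Cons g fs)
  then obtain j r b where 1: "j \<in> J" "b \<in> lin fs (adjoin J f)" "x = g * (j + f * r) + b"
    by (auto simp: adjoin_def)
  then obtain c d where 2: "c \<in> lin fs J" "b = c + f * d" using Cons.IH by blast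
  have "x = (g * j + c) + f * (g * r + d)" using 1 2 by (simp add: algebra_simps)
  moreover have "g * j + c \<in> lin (g # fs) J" using 1 2 by (intro lin_ConsI) auto
  ultimately show ?case by blast
qed

lemma lin_subset_ideal: "ring_ideal J \<Longrightarrow> lin fs J \<subseteq> J"
  by (induction fs) (auto simp: ring_ideal_0 ring_ideal_add ring_ideal_mult)

text \<open>This expresses the vanishing of \<open>Tor\<^sub>1(R/(fs), R/J)\<close>.\<close>

lemma wreg_Int_lin:
  assumes "ring_ideal J" "wreg fs J"
  shows "J \<inter> lin fs UNIV \<subseteq> lin fs J"
  using assms
proof (induction fs arbitrary: J)
  case (Cons f fs)
  show ?case
  proof
    fix x assume "x \<in> J \<inter> lin (f # fs) UNIV"
    then obtain a b where x: "x \<in> J" "b \<in> lin fs UNIV" "x = f * a + b" by auto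
    \<comment> \<open>Since \<open>b = x - f * a\<close>, the induction hypothesis applies to
      \<open>b\<close> and (J,f). The resulting multiple of \<open>f\<close> is absorbed into the
      coefficient of \<open>f\<close>, which then lies in \<open>J\<close> because \<open>f\<close>
      is a nonzerodivisor modulo \<open>J\<close>.\<close>
    then have "b \<in> adjoin J f" by (intro adjoinI[of x _ _ f "- a"]) auto
    then have "b \<in> lin fs (adjoin J f)"
      using Cons.IH[of "adjoin J f"] Cons.prems x by (auto simp: ring_ideal_adjoin)
    then obtain c d where c: "c \<in> lin fs J" "b = c + f * d"
      using lin_adjoin by blast
    have "f * (a + d) = x - c" using x c by (simp add: algebra_simps)
    moreover have "c \<in> J" using c lin_subset_ideal Cons.prems(1) by blast
    ultimately have "f * (a + d) \<in> J" using x Cons.prems(1) by (simp add: ring_ideal_diff)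
    then have "a + d \<in> J" using Cons.prems(2) by (auto simp: nzd_mod_def colon_def)
    moreover have "x = f * (a + d) + c" using x c by (simp add: algebra_simps)
    ultimately show "x \<in> lin (f # fs) J" using c by auto
  qed
qed auto

section \<open>Squarefree monomial ideals\<close>

type_synonym mono = "nat \<Rightarrow>\<^sub>0 nat"

section \<open>Supports, restriction to a set of monomials, squarefree monomials\<close>

abbreviation (input) supp :: "('k \<Rightarrow>\<^sub>0 'b::zero) \<Rightarrow> 'k set" where
  "supp \<equiv> Poly_Mapping.keys"

abbreviation (input) coeff :: "('k \<Rightarrow>\<^sub>0 'b::zero) \<Rightarrow> 'k \<Rightarrow> 'b" where
  "coeff \<equiv> Poly_Mapping.lookup"

text \<open>Serves both as truncation by degree and, in \<open>proj\<close>, as projection to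
  finitely many variables.\<close>

definition filt :: "('k \<Rightarrow> bool) \<Rightarrow> ('k \<Rightarrow>\<^sub>0 'b::zero) \<Rightarrow> ('k \<Rightarrow>\<^sub>0 'b)" where
  "filt P p = Poly_Mapping.mapp (\<lambda>t c. if P t then c else 0) p"

lemma coeff_filt: "coeff (filt P p) t = (if P t then coeff p t else 0)"
  by (simp add: filt_def lookup_mapp when_def in_keys_iff)

lemma supp_filt: "supp (filt P p) = {t \<in> supp p. P t}"
  by (auto simp: in_keys_iff coeff_filt split: if_splits)

lemma filt_add: "filt P (p + q) = filt P p + filt P (q :: 'k \<Rightarrow>\<^sub>0 'b::monoid_add)"
  by (rule poly_mapping_eqI) (simp add: coeff_filt lookup_add)

lemma filt_split: "p = filt P p + filt (\<lambda>t. \<not> P t) (p :: 'k \<Rightarrow>\<^sub>0 'b::monoid_add)"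
  by (rule poly_mapping_eqI) (simp add: coeff_filt lookup_add)

lemma filt_id: "(\<And>t. t \<in> supp p \<Longrightarrow> P t) \<Longrightarrow> filt P p = p"
  by (rule poly_mapping_eqI) (auto simp: coeff_filt in_keys_iff)

lemma filt_zero: "(\<And>t. t \<in> supp p \<Longrightarrow> \<not> P t) \<Longrightarrow> filt P p = 0"
  by (rule poly_mapping_eqI) (auto simp: coeff_filt in_keys_iff)

text \<open>The hypothesis holds for degree bounds when \<open>f\<close> is homogeneous, and for the
  restriction to variables in \<open>{1..n}\<close> when \<open>f\<close> lies in the ring of
  \<open>n\<close> variables.\<close>

lemma filt_mult:
  fixes f r :: "'k::monoid_add \<Rightarrow>\<^sub>0 'b::semiring_0"
  assumes "\<And>s t. s \<in> supp f \<Longrightarrow> P (s + t) \<longleftrightarrow> Q t"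
  shows "filt P (f * r) = f * filt Q r"
proof -
  have "filt P (f * filt Q r) = f * filt Q r"
    using assms keys_mult[of f "filt Q r"] by (intro filt_id) (auto simp: supp_filt)
  moreover have "filt P (f * filt (\<lambda>t. \<not> Q t) r) = 0"
    using assms keys_mult[of f "filt (\<lambda>t. \<not> Q t) r"] by (intro filt_zero) (auto simp: supp_filt)
  ultimately show ?thesis
    by (subst filt_split[of r Q]) (simp add: distrib_left filt_add)
qed

lemma supp_add_nat: "supp (s + t) = supp s \<union> supp (t :: 'k \<Rightarrow>\<^sub>0 nat)"
  by (auto simp: in_keys_iff lookup_add)

lemma poly_mapping_sum_single: "p = (\<Sum>t\<in>supp p. Poly_Mapping.single t (coeff p t))"
  by (rule poly_mapping_eqI) (auto simp: lookup_sum lookup_single when_def in_keys_iff)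

lemma coeff_single_mult:
  "coeff (Poly_Mapping.single a 1 * p) (a + t) = coeff (p :: 'k::cancel_comm_monoid_add \<Rightarrow>\<^sub>0 'b::semiring_1) t"
  by (simp add: lookup_mult lookup_single when_mult)

lemma supp_single_mult:
  "supp (Poly_Mapping.single a 1 * p) = (+) a ` supp (p :: 'k::cancel_comm_monoid_add \<Rightarrow>\<^sub>0 'b::semiring_1)"
proof
  show "supp (Poly_Mapping.single a 1 * p) \<subseteq> (+) a ` supp p"
    using keys_mult[of "Poly_Mapping.single a 1" p] by (auto split: if_splits)
  show "(+) a ` supp p \<subseteq> supp (Poly_Mapping.single a 1 * p)"
    by (auto simp: in_keys_iff coeff_single_mult)
qed

text \<open>The exponent vector of the squarefree monomial with support \<open>S\<close>. An
  infinite \<open>S\<close> would give \<open>0\<close>, whence the finiteness assumptions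
  below.\<close>

definition ind :: "nat set \<Rightarrow> mono" where
  "ind S = (\<Sum>v\<in>S. Poly_Mapping.single v 1)"

definition sqm :: "nat set \<Rightarrow> 'a::field mpoly" where
  "sqm S = Poly_Mapping.single (ind S) 1"

lemma coeff_ind: "finite S \<Longrightarrow> coeff (ind S) v = (if v \<in> S then 1 else 0)"
  by (simp add: ind_def lookup_sum lookup_single when_def)

lemma supp_ind: "finite S \<Longrightarrow> supp (ind S) = S"
  by (auto simp: in_keys_iff coeff_ind split: if_splits)

lemma supp_sqm: "supp (sqm S :: 'a::field mpoly) = {ind S}"
  by (simp add: sqm_def)

lemma ind_insert: "finite S \<Longrightarrow> v \<notin> S \<Longrightarrow> ind (insert v S) = Poly_Mapping.single v 1 + ind S"
  by (simp add: ind_def)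

lemma sqm_insert: "finite S \<Longrightarrow> v \<notin> S \<Longrightarrow> sqm (insert v S) = Var v * sqm S"
  by (simp add: sqm_def Var_def ind_insert mult_single)

lemma sqm_empty: "sqm {} = 1"
  by (simp add: sqm_def ind_def)

lemma Var_eq_sqm: "Var v = sqm {v}"
  by (simp add: sqm_def Var_def ind_def)

lemma prod_Var: "finite S \<Longrightarrow> (\<Prod>v\<in>S. Var v) = sqm S"
  by (induction S rule: finite_induct) (auto simp: sqm_empty sqm_insert)

lemma ind_add_diff:
  assumes "finite S" "S \<subseteq> supp t"
  shows "ind S + (t - ind S) = t"
proof (rule poly_mapping_eqI)
  fix v show "coeff (ind S + (t - ind S)) v = coeff t v"
    using assms by (auto simp: lookup_add lookup_minus coeff_ind in_keys_iff subset_iff Suc_le_eq)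
qed

lemma single_dvd_by_sqm:
  assumes "finite S" "S \<subseteq> supp t"
  shows "Poly_Mapping.single t c = sqm S * Poly_Mapping.single (t - ind S) c"
  using ind_add_diff[OF assms] by (simp add: sqm_def mult_single)

text \<open>A squarefree monomial ideal is recorded by the up-closed family of the supports
  of its monomials.\<close>

definition monid :: "nat set set \<Rightarrow> 'a::field mpoly set" where
  "monid U = {p. \<forall>t\<in>supp p. supp t \<in> U}"

definition upset :: "nat set set \<Rightarrow> bool" where
  "upset U \<longleftrightarrow> (\<forall>S\<in>U. \<forall>T. S \<subseteq> T \<longrightarrow> T \<in> U)"

lemma ring_ideal_monid:
  assumes "upset U"
  shows "ring_ideal (monid U :: 'a::field mpoly set)"
  unfolding ring_ideal_def
proof (intro conjI ballI allI)
  fix p q :: "'a mpoly" assume "p \<in> monid U" "q \<in> monid U"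
  then show "p + q \<in> monid U"
    using Poly_Mapping.keys_add[of p q] by (auto simp: monid_def)
next
  fix p r :: "'a mpoly" assume p: "p \<in> monid U"
  show "r * p \<in> monid U"
    unfolding monid_def
  proof (safe)
    fix t assume "t \<in> supp (r * p)"
    then obtain a b where "t = a + b" "b \<in> supp p" using keys_mult[of r p] by auto
    then show "supp t \<in> U"
      using p assms unfolding monid_def upset_def by (auto simp: supp_add_nat)
  qed
qed (simp add: monid_def)

lemma colon_monid:
  assumes "finite S"
  shows "colon (monid U) (sqm S) = (monid {T. T \<union> S \<in> U} :: 'a::field mpoly set)"
  using assms by (auto simp: colon_def monid_def sqm_def supp_single_mult supp_add_nat supp_ind Un_commute)

lemma adjoin_monid:
  assumes "upset U" "finite S"
  shows "adjoin (monid U) (sqm S) = (monid (U \<union> {T. S \<subseteq> T}) :: 'a::field mpoly set)"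
proof
  have up: "upset (U \<union> {T. S \<subseteq> T})" using assms(1) by (auto simp: upset_def)
  have "sqm S \<in> (monid (U \<union> {T. S \<subseteq> T}) :: 'a mpoly set)"
    using assms(2) by (simp add: monid_def supp_sqm supp_ind)
  moreover have "monid U \<subseteq> (monid (U \<union> {T. S \<subseteq> T}) :: 'a mpoly set)"
    by (auto simp: monid_def)
  ultimately show "adjoin (monid U) (sqm S) \<subseteq> (monid (U \<union> {T. S \<subseteq> T}) :: 'a mpoly set)"
    using ring_ideal_monid[OF up, where 'a = 'a]
    by (auto elim!: adjoinE intro!: ring_ideal_add ring_ideal_mult2)
next
  note id = ring_ideal_adjoin[OF ring_ideal_monid[OF assms(1), where 'a = 'a], of "sqm S"]
  show "(monid (U \<union> {T. S \<subseteq> T}) :: 'a mpoly set) \<subseteq> adjoin (monid U) (sqm S)"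
  proof
    fix p :: "'a mpoly" assume p: "p \<in> monid (U \<union> {T. S \<subseteq> T})"
    have "Poly_Mapping.single t (coeff p t) \<in> adjoin (monid U) (sqm S)" if t: "t \<in> supp p" for t
    proof (cases "supp t \<in> U")
      case True
      then have "Poly_Mapping.single t (coeff p t) \<in> monid U" by (simp add: monid_def)
      then show ?thesis using subset_adjoin by blast
    next
      case False
      then have "S \<subseteq> supp t" using p t by (auto simp: monid_def)
      then have "Poly_Mapping.single t (coeff p t)
          = 0 + sqm S * Poly_Mapping.single (t - ind S) (coeff p t)"
        using single_dvd_by_sqm assms(2) by simp
      then show ?thesis
        using assms(1) by (intro adjoinI[of 0]) (auto simp: ring_ideal_0 ring_ideal_monid)
    qed
    then show "p \<in> adjoin (monid U) (sqm S)"
      by (subst poly_mapping_sum_single[of p]) (auto intro!: ring_ideal_sum id)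
  qed
qed

text \<open>In this form the splitting argument only involves set families.\<close>

lemma wreg_monid_split:
  fixes fs :: "'a::field mpoly list"
  assumes "upset U" "finite S" "wreg fs (monid {T. T \<union> S \<in> U})" "wreg fs (monid (U \<union> {T. S \<subseteq> T}))"
  shows "wreg fs (monid U)"
  using assms wreg_split[OF ring_ideal_monid[OF assms(1)], of fs "sqm S"]
  by (simp add: colon_monid adjoin_monid)

section \<open>Elementary symmetric polynomials\<close>

definition deg :: "mono \<Rightarrow> nat" where
  "deg t = Sum_any (coeff t)"

lemma deg_add: "deg (s + t) = deg s + deg t"
  by (simp add: deg_def lookup_add Sum_any.distrib)

lemma deg_ind:
  assumes "finite S"
  shows "deg (ind S) = card S"
proof -
  have "deg (ind S) = (\<Sum>v\<in>S. coeff (ind S) v)"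
    unfolding deg_def using assms by (intro Sum_any.expand_superset) (auto simp: coeff_ind split: if_splits)
  then show ?thesis using assms by (simp add: coeff_ind)
qed

text \<open>For an ideal this amounts to being homogeneous, since a homogeneous component is the
  difference of two truncations.\<close>

definition trunc_closed :: "'a::field mpoly set \<Rightarrow> bool" where
  "trunc_closed J \<longleftrightarrow> (\<forall>p\<in>J. \<forall>D. filt (\<lambda>t. deg t < D) p \<in> J)"

definition homog :: "nat \<Rightarrow> 'a::field mpoly \<Rightarrow> bool" where
  "homog a f \<longleftrightarrow> (\<forall>t\<in>supp f. deg t = a)"

lemma filt_homog_mult: "homog a f \<Longrightarrow> filt (\<lambda>t. deg t < D) (f * r) = f * filt (\<lambda>t. a + deg t < D) r"
  by (rule filt_mult) (simp add: homog_def deg_add)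

lemma trunc_closed_adjoin:
  assumes "trunc_closed J" "homog a f"
  shows "trunc_closed (adjoin J f)"
  unfolding trunc_closed_def
proof (intro ballI allI)
  fix p D assume "p \<in> adjoin J f"
  then obtain j r where "j \<in> J" "p = j + f * r" by (auto elim!: adjoinE)
  then show "filt (\<lambda>t. deg t < D) p \<in> adjoin J f"
    using assms
    by (intro adjoinI[of "filt (\<lambda>t. deg t < D) j" _ _ f "filt (\<lambda>t. a + deg t < D) r"])
      (auto simp: trunc_closed_def filt_add filt_homog_mult)
qed

lemma trunc_closed_monid: "trunc_closed (monid U)"
  by (auto simp: trunc_closed_def monid_def supp_filt)

text \<open>A form of the graded Nakayama lemma.\<close>

lemma nzd_mod_of_adjoin:
  assumes J: "ring_ideal J" "trunc_closed J" and v: "nzd_mod v J" "homog 1 v"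
    and f: "nzd_mod f (adjoin J v)"
  shows "nzd_mod f J"
proof -
  \<comment> \<open>Induction on a strict bound \<open>D\<close> for the degrees in
    \<open>x\<close>: in \<open>x = j' + v * r'\<close> the factor \<open>r'\<close> has smaller
    degree, and \<open>f * r'\<close> is again in \<open>J\<close> since \<open>v\<close> can be
    cancelled.\<close>
  have *: "x \<in> J" if "f * x \<in> J" "\<forall>t\<in>supp x. deg t < D" for x D
    using that
  proof (induction D arbitrary: x)
    case 0
    then have "supp x = {}" by auto
    then show ?case using J(1) by (simp add: ring_ideal_0)
  next
    case (Suc D)
    have "x \<in> adjoin J v"
      using f Suc.prems(1) subset_adjoin[of J v] by (auto simp: nzd_mod_def colon_def)
    then obtain j r where j: "j \<in> J" "x = j + v * r" by (auto elim!: adjoinE)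
    define j' where "j' = filt (\<lambda>t. deg t < Suc D) j"
    define r' where "r' = filt (\<lambda>t. 1 + deg t < Suc D) r"
    have j': "j' \<in> J" using j J(2) by (simp add: j'_def trunc_closed_def)
    have "x = filt (\<lambda>t. deg t < Suc D) x" using Suc.prems(2) by (simp add: filt_id)
    then have x: "x = j' + v * r'"
      by (simp add: j j'_def r'_def filt_add filt_homog_mult[OF v(2)])
    have "v * (f * r') = f * x - f * j'" by (simp add: x algebra_simps)
    then have "v * (f * r') \<in> J" using J(1) j' Suc.prems(1) by (simp add: ring_ideal_diff ring_ideal_mult)
    then have "f * r' \<in> J" using v(1) by (auto simp: nzd_mod_def colon_def)
    then have "r' \<in> J" using Suc.IH by (auto simp: r'_def supp_filt)
    then show ?case using x j' J(1) by (simp add: ring_ideal_add ring_ideal_mult)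
  qed
  have "\<exists>D. \<forall>t\<in>supp x. deg t < D" for x :: "'a mpoly"
    using finite_nat_bounded[of "deg ` supp x"] by auto
  then show ?thesis using * by (force simp: nzd_mod_def colon_def)
qed

text \<open>The element \<open>v\<close> moves from the front of the sequence to its end. Each
  \<open>f\<close> is a nonzerodivisor on R/J by \<open>nzd_mod_of_adjoin\<close>, and
  \<open>v\<close> remains one modulo \<open>f\<close>: a relation \<open>v * r = j + f * s\<close>
  forces \<open>s\<close> into (J,v), after which \<open>v\<close> cancels.\<close>

lemma wreg_snoc_var:
  assumes "ring_ideal J" "trunc_closed J" "nzd_mod v J" "homog 1 v"
    and "\<forall>f\<in>set fs. \<exists>a. homog a f" "wreg fs (adjoin J v)"
  shows "wreg (fs @ [v]) J"
  using assms
proof (induction fs arbitrary: J)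
  case (Cons f fs)
  have f: "nzd_mod f (adjoin J v)" and fs: "wreg fs (adjoin (adjoin J v) f)"
    using Cons.prems by auto
  have "nzd_mod v (adjoin J f)"
    unfolding nzd_mod_def
  proof
    fix r assume "r \<in> colon (adjoin J f) v"
    then obtain j s where j: "j \<in> J" "v * r = j + f * s" by (auto simp: colon_def elim!: adjoinE)
    have "f * s = - j + v * r" using j by simp
    then have "f * s \<in> adjoin J v"
      using j Cons.prems(1) by (intro adjoinI[of "- j" _ _ v r]) (auto simp: ring_ideal_uminus)
    then have "s \<in> adjoin J v" using f by (auto simp: nzd_mod_def colon_def)
    then obtain j' s' where j': "j' \<in> J" "s = j' + v * s'" by (auto elim!: adjoinE)
    have "v * (r - f * s') = j + f * j'" using j j' by (simp add: algebra_simps)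
    then have "v * (r - f * s') \<in> J"
      using j j' Cons.prems(1) by (simp add: ring_ideal_add ring_ideal_mult)
    then have "r - f * s' \<in> J" using Cons.prems(3) by (auto simp: nzd_mod_def colon_def)
    then show "r \<in> adjoin J f" by (intro adjoinI[of "r - f * s'" _ _ f s']) auto
  qed
  moreover have "nzd_mod f J" using Cons.prems f nzd_mod_of_adjoin[of J v f] by blast
  moreover have "trunc_closed (adjoin J f)" using Cons.prems trunc_closed_adjoin[of J _ f] by auto
  ultimately show ?case
    using Cons.prems fs Cons.IH[of "adjoin J f"] by (simp add: ring_ideal_adjoin adjoin_commute)
qed simp

section \<open>Elementary symmetric polynomials on coordinate quotients\<close>

definition elem_sym :: "nat \<Rightarrow> nat \<Rightarrow> 'a::field mpoly" where
  "elem_sym n i = (\<Sum>S\<in>{S. S \<subseteq> {1..n} \<and> card S = i}. sqm S)"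

lemma supp_sum_subset: "supp (sum g A) \<subseteq> (\<Union>i\<in>A. supp (g i))"
  for g :: "'i \<Rightarrow> 'k \<Rightarrow>\<^sub>0 'b::comm_monoid_add"
  by (induction A rule: infinite_finite_induct) (use Poly_Mapping.keys_add in fastforce)+

lemma supp_elem_sym: "t \<in> supp (elem_sym n i :: 'a::field mpoly) \<Longrightarrow> \<exists>S. S \<subseteq> {1..n} \<and> card S = i \<and> t = ind S"
  using supp_sum_subset[of "sqm :: _ \<Rightarrow> 'a mpoly" "{S. S \<subseteq> {1..n} \<and> card S = i}"]
  by (auto simp: elem_sym_def supp_sqm)

lemma homog_elem_sym: "homog i (elem_sym n i)"
  by (auto simp: homog_def dest!: supp_elem_sym) (meson deg_ind finite_atLeastAtMost finite_subset)

text \<open>The order is descending: on exactly \<open>d\<close> variables the polynomial of degree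
  \<open>d\<close> comes first and acts as a monomial, and splitting along it leaves rings in
  \<open>d - 1\<close> variables for the rest.\<close>

primrec elem_syms :: "nat \<Rightarrow> nat \<Rightarrow> 'a::field mpoly list" where
  "elem_syms n 0 = []"
| "elem_syms n (Suc d) = elem_sym n (Suc d) # elem_syms n d"

lemma set_elem_syms: "set (elem_syms n d) = elem_sym n ` {1..d}"
  by (induction d) (auto simp: atLeastAtMostSuc_conv)

lemma length_elem_syms: "length (elem_syms n d) = d"
  by (induction d) auto

text \<open>\<open>monid (not_within F)\<close> is the prime ideal generated by the variables
  outside \<open>F\<close>, with quotient the polynomial ring in the variables of \<open>F\<close>.
  The variables with index outside \<open>{1..n}\<close> are removed in the same way.\<close>

definition not_within :: "nat set \<Rightarrow> nat set set" where
  "not_within F = {S. \<not> S \<subseteq> F}"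

lemma upset_not_within: "upset (not_within F)"
  by (auto simp: upset_def not_within_def)

lemma upset_Un: "upset U \<Longrightarrow> upset V \<Longrightarrow> upset (U \<union> V)"
  by (auto simp: upset_def)

lemma upset_supersets: "upset {T. S \<subseteq> T}"
  by (auto simp: upset_def)

lemma not_within_remove: "v \<in> F \<Longrightarrow> not_within F \<union> {T. {v} \<subseteq> T} = not_within (F - {v})"
  by (auto simp: not_within_def)

lemma nzd_sqm_not_within:
  assumes "finite S" "S \<subseteq> F"
  shows "nzd_mod (sqm S) (monid (not_within F))"
proof -
  have "{T. T \<union> S \<in> not_within F} = not_within F" using assms(2) by (auto simp: not_within_def)
  then show ?thesis using assms(1) by (simp add: nzd_mod_def colon_monid)
qed

text \<open>A set of the same size as \<open>F\<close> and contained in \<open>F\<close> is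
  \<open>F\<close> itself, so all other terms involve a variable outside \<open>F\<close>.\<close>

lemma elem_sym_mod_not_within:
  assumes "F \<subseteq> {1..n}"
  shows "elem_sym n (card F) - sqm F \<in> (monid (not_within F) :: 'a::field mpoly set)"
proof -
  let ?A = "{S. S \<subseteq> {1..n} \<and> card S = card F}"
  have fin: "finite ?A" by (rule finite_subset[of _ "Pow {1..n}"]) auto
  have "elem_sym n (card F) - sqm F = (\<Sum>S\<in>?A - {F}. sqm S :: 'a mpoly)"
    unfolding elem_sym_def using assms fin by (subst sum.remove[of _ F]) auto
  moreover have "sqm S \<in> (monid (not_within F) :: 'a mpoly set)" if "S \<in> ?A - {F}" for S
  proof -
    have "finite F" "finite S" using assms that finite_subset by auto
    moreover have "\<not> S \<subseteq> F" using that card_subset_eq[OF \<open>finite F\<close>, of S] by auto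
    ultimately show ?thesis by (simp add: monid_def supp_sqm supp_ind not_within_def)
  qed
  ultimately show ?thesis
    by (auto intro!: ring_ideal_sum ring_ideal_monid upset_not_within)
qed

text \<open>Outer induction on \<open>d\<close>, inner induction on the size of \<open>F\<close>.
  With just enough variables the first polynomial becomes a product of variables, and the splitting
  lemma applies; with more, one variable is divided out and \<open>wreg_snoc_var\<close> lifts the
  result.\<close>

lemma wreg_elem_syms_not_within:
  assumes "F \<subseteq> {1..n}" "d \<le> card F"
  shows "wreg (elem_syms n d :: 'a::field mpoly list) (monid (not_within F))"
  using assms
proof (induction d arbitrary: F)
  case (Suc d F)
  note outer = Suc.IH
  from Suc.prems show ?case
  proof (induction "card F" arbitrary: F rule: less_induct)
    case less
    let ?J = "monid (not_within F) :: 'a mpoly set"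
    have fin: "finite F" using less.prems(1) finite_subset by auto
    note id = ring_ideal_monid[OF upset_not_within, of F, where 'a = 'a]
    show ?case
    proof (cases "card F = Suc d")
      case True
      have md: "elem_sym n (Suc d) - sqm F \<in> ?J"
        using elem_sym_mod_not_within[OF less.prems(1)] True by simp
      have step: "wreg (elem_syms n d :: 'a mpoly list) (monid (not_within (F - {v})))" if "v \<in> F" for v
        using outer[of "F - {v}"] less.prems(1) True that fin by auto
      \<comment> \<open>Split off one variable \<open>v\<close> of the product over
        \<open>G\<close>: the colon leaves the product of the others, and adjoining \<open>v\<close>
        leaves a polynomial ring in \<open>d\<close> variables.\<close>
      have "wreg (elem_syms n d :: 'a mpoly list) (monid (not_within F \<union> {T. G \<subseteq> T}))"
        if "finite G" "G \<noteq> {}" "G \<subseteq> F" for G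
        using that
      proof (induction G rule: finite_ne_induct)
        case (singleton v)
        then show ?case using step[of v] not_within_remove[of v F] by simp
      next
        case (insert v G)
        show ?case
        proof (rule wreg_monid_split[of _ "{v}"])
          show "upset (not_within F \<union> {T. insert v G \<subseteq> T})"
            by (intro upset_Un upset_not_within upset_supersets)
          have "{T. T \<union> {v} \<in> not_within F \<union> {T. insert v G \<subseteq> T}} = not_within F \<union> {T. G \<subseteq> T}"
            using insert.hyps insert.prems by (auto simp: not_within_def)
          then show "wreg (elem_syms n d :: 'a mpoly list)
              (monid {T. T \<union> {v} \<in> not_within F \<union> {T. insert v G \<subseteq> T}})"
            using insert by simp
          have "not_within F \<union> {T. insert v G \<subseteq> T} \<union> {T. {v} \<subseteq> T} = not_within (F - {v})"
            using insert.prems by (auto simp: not_within_def)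
          then show "wreg (elem_syms n d :: 'a mpoly list)
              (monid (not_within F \<union> {T. insert v G \<subseteq> T} \<union> {T. {v} \<subseteq> T}))"
            using step[of v] insert.prems by simp
        qed simp
      qed
      note prods = this
      have "F \<noteq> {}" using True by auto
      then have "wreg (elem_syms n d :: 'a mpoly list) (monid (not_within F \<union> {T. F \<subseteq> T}))"
        using fin by (intro prods) auto
      then have "wreg (elem_syms n d :: 'a mpoly list) (adjoin ?J (elem_sym n (Suc d)))"
        unfolding adjoin_cong_mod[OF id md] adjoin_monid[OF upset_not_within fin] .
      moreover have "nzd_mod (elem_sym n (Suc d)) ?J"
        using nzd_sqm_not_within[OF fin, of F, where 'a = 'a] colon_cong_mod[OF id md] by (simp add: nzd_mod_def)
      ultimately show ?thesis by simp
    next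
      case False
      then obtain v where v: "v \<in> F" using less.prems(2) by fastforce
      have "wreg (elem_syms n (Suc d) :: 'a mpoly list) (monid (not_within (F - {v})))"
        using less.prems False v fin by (intro less.hyps) auto
      then have "wreg (elem_syms n (Suc d) :: 'a mpoly list) (adjoin ?J (sqm {v}))"
        using not_within_remove[OF v] by (simp add: adjoin_monid upset_not_within)
      moreover have "nzd_mod (sqm {v}) ?J" using v by (intro nzd_sqm_not_within) auto
      moreover have "homog 1 (sqm {v} :: 'a mpoly)" by (simp add: homog_def supp_sqm deg_ind)
      ultimately have "wreg (elem_syms n (Suc d) @ [sqm {v}] :: 'a mpoly list) ?J"
        by (intro wreg_snoc_var id trunc_closed_monid) (auto simp: set_elem_syms intro: homog_elem_sym)
      then show ?thesis by (simp only: wreg_append)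
    qed
  qed
qed simp

text \<open>Modulo the first variable there remain \<open>n - 1\<close>, hence at least
  \<open>d\<close>, variables; the variable itself is then appended by
  \<open>wreg_snoc_var\<close>.\<close>

lemma wreg_elem_syms_snoc:
  assumes "d < n"
  shows "wreg (elem_syms n d @ [sqm {1}] :: 'a::field mpoly list) (monid (not_within {1..n}))"
proof (rule wreg_snoc_var)
  have "{1..n} - {1} \<subseteq> {1..n}" "card ({1..n} - {1}) = n - 1"
    using assms by (auto simp: card_Diff_singleton simp del: One_nat_def)
  then have "wreg (elem_syms n d :: 'a mpoly list) (monid (not_within ({1..n} - {1})))"
    using assms by (intro wreg_elem_syms_not_within) linarith+
  then show "wreg (elem_syms n d :: 'a mpoly list) (adjoin (monid (not_within {1..n})) (sqm {1}))"
    using assms not_within_remove[of 1 "{1..n}"] by (simp add: adjoin_monid upset_not_within)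
  show "nzd_mod (sqm {1}) (monid (not_within {1..n}))"
    using assms by (intro nzd_sqm_not_within) auto
  show "homog 1 (sqm {1} :: 'a mpoly)" by (simp add: homog_def supp_sqm deg_ind)
  show "\<forall>f\<in>set (elem_syms n d). \<exists>a. homog a (f :: 'a mpoly)"
    using homog_elem_sym by (auto simp: set_elem_syms)
qed (rule ring_ideal_monid upset_not_within trunc_closed_monid)+

section \<open>Splitting the path ideal\<close>

text \<open>The support of the generator u_(i+1), with \<open>s = m - l\<close>; indices start at
  0.\<close>

definition window :: "nat \<Rightarrow> nat \<Rightarrow> nat \<Rightarrow> nat set" where
  "window s m i = {i * s + 1..i * s + m}"

definition path_family :: "nat \<Rightarrow> nat \<Rightarrow> nat \<Rightarrow> nat set set" where
  "path_family s m k = {S. \<exists>i<k. window s m i \<subseteq> S}"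

text \<open>The variables outside \<open>F\<close>, a first generator \<open>x\<^bsub>p+1\<^esub> \<cdots> x\<^bsub>r\<^esub>\<close>,
  and the generators of the path ideal starting beyond \<open>x\<^bsub>p+1\<^esub>\<close>.\<close>

definition path_state :: "nat \<Rightarrow> nat \<Rightarrow> nat \<Rightarrow> nat set \<Rightarrow> nat \<Rightarrow> nat \<Rightarrow> nat set set" where
  "path_state s m k F p r =
    {S. \<not> S \<subseteq> F \<or> {p + 1..r} \<subseteq> S \<or> (\<exists>i<k. p < i * s \<and> window s m i \<subseteq> S)}"

text \<open>The least \<open>i\<close> with \<open>p < i * s\<close> is \<open>p div s + 1\<close>,
  so this is the index of the last variable of the first generator starting beyond x_(p+1).\<close>

definition next_end :: "nat \<Rightarrow> nat \<Rightarrow> nat \<Rightarrow> nat" where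
  "next_end s m p = (p div s + 1) * s + m"

text \<open>Counts the numbers r, r + (m+s), r + 2(m+s), ... and e, e + (m+s), ... that are at most
  \<open>n\<close>, where e is \<open>next_end s m p\<close>. If \<open>s\<close> divides
  \<open>r\<close> and \<open>m\<close>, these are the ends of the first generators met along
  repeated colon steps, each of which costs one variable.\<close>

definition path_codim :: "nat \<Rightarrow> nat \<Rightarrow> nat \<Rightarrow> nat \<Rightarrow> nat \<Rightarrow> nat" where
  "path_codim s m n p r = (n + (m + s) - r) div (m + s) + (n + (m + s) - next_end s m p) div (m + s)"

lemma upset_path_state: "upset (path_state s m k F p r)"
  unfolding upset_def path_state_def by blast

lemma mult_gt_iff_ge_div: "s > 0 \<Longrightarrow> p < i * s \<longleftrightarrow> p div s + 1 \<le> (i::nat)"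
  by (metis Suc_eq_plus1 Suc_le_eq div_less_iff_less_mult)

text \<open>The monomial is the first generator without its first variable, so this generator
  becomes x_(p+1), which leaves \<open>F\<close>. A later generator with
  \<open>i * s \<le> r\<close> keeps only its part beyond \<open>r\<close>. The least later index
  satisfies this bound because \<open>s\<close> divides \<open>r\<close>, and gives the new first
  generator; if it is not below \<open>k\<close>, no generator remains.\<close>

lemma path_state_colon:
  assumes s: "s > 0" and pr: "p < r" "r \<le> p + m" "s dvd r" and F: "{p + 1..n} \<subseteq> F" "r \<le> n"
  shows "{T. T \<union> {p + 2..r} \<in> path_state s m k F p r}
    = (if p div s + 1 < k then path_state s m k (F - {p + 1}) r (next_end s m p)
       else not_within (F - {p + 1}))" (is "?L = ?R")
proof -
  define i0 where "i0 = p div s + 1"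
  have i0: "p < i * s \<longleftrightarrow> i0 \<le> i" for i using mult_gt_iff_ge_div[OF s] by (simp add: i0_def)
  obtain c where c: "r = c * s" using pr(3) by (metis dvd_div_mult_self)
  have i0r: "i0 * s \<le> r" using i0[of c] pr(1) c by simp
  have end_eq: "next_end s m p = i0 * s + m" by (simp add: next_end_def i0_def)
  have sub: "{p + 2..r} \<subseteq> F" using F by (auto simp: subset_iff)
  have gen1: "{p + 1..r} \<subseteq> T \<union> {p + 2..r} \<longleftrightarrow> p + 1 \<in> T" for T
    using pr(1) by (auto simp: subset_iff) (metis Suc_leI le_antisym not_less_eq_eq)
  have gen2: "window s m i \<subseteq> T \<union> {p + 2..r} \<longleftrightarrow> (if i * s \<le> r then {r + 1..i * s + m} \<subseteq> T else window s m i \<subseteq> T)"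
    if "p < i * s" for i T
  proof (cases "i * s \<le> r")
    case True
    have "window s m i \<subseteq> T \<union> {p + 2..r} \<longleftrightarrow> window s m i - {p + 2..r} \<subseteq> T" by auto
    also have "window s m i - {p + 2..r} = {r + 1..i * s + m}"
      using True that by (auto simp: window_def)
    finally show ?thesis using True by simp
  next
    case False
    then have "window s m i \<inter> {p + 2..r} = {}" by (auto simp: window_def)
    then show ?thesis using False by auto
  qed
  have L: "T \<in> ?L \<longleftrightarrow> \<not> T \<subseteq> F - {p + 1} \<or>
      (\<exists>i<k. p < i * s \<and> (if i * s \<le> r then {r + 1..i * s + m} \<subseteq> T else window s m i \<subseteq> T))" for T
    using sub gen1[of T] gen2[of _ T] unfolding path_state_def by blast
  show ?thesis
  proof (cases "i0 < k")
    case True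
    \<comment> \<open>The shortened generators all start at \<open>r + 1\<close>, so the shortest
      one, with index \<open>i0\<close>, divides the others.\<close>
    have AB: "(\<exists>i<k. p < i * s \<and> (if i * s \<le> r then {r + 1..i * s + m} \<subseteq> T else window s m i \<subseteq> T)) \<longleftrightarrow>
        {r + 1..i0 * s + m} \<subseteq> T \<or> (\<exists>i<k. r < i * s \<and> window s m i \<subseteq> T)" (is "?A \<longleftrightarrow> ?B") for T
    proof
      assume ?A
      then obtain i where i: "i < k" "i0 \<le> i"
        "if i * s \<le> r then {r + 1..i * s + m} \<subseteq> T else window s m i \<subseteq> T" using i0 by blast
      have "i0 * s \<le> i * s" using i by simp
      then have "{r + 1..i0 * s + m} \<subseteq> {r + 1..i * s + m}" by auto
      then show ?B using i order_trans[of "{r + 1..i0 * s + m}" "{r + 1..i * s + m}" T]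
        by (metis not_le)
    next
      assume ?B
      then show ?A
      proof
        assume "{r + 1..i0 * s + m} \<subseteq> T"
        then show ?A using True i0 i0r by auto
      next
        assume "\<exists>i<k. r < i * s \<and> window s m i \<subseteq> T"
        then show ?A using pr(1) by (metis not_le order.strict_trans)
      qed
    qed
    have "?L = path_state s m k (F - {p + 1}) r (i0 * s + m)"
    proof (rule Set.set_eqI)
      fix T show "T \<in> ?L \<longleftrightarrow> T \<in> path_state s m k (F - {p + 1}) r (i0 * s + m)"
        unfolding L AB by (simp only: path_state_def mem_Collect_eq)
    qed
    then show ?thesis using True unfolding end_eq i0_def[symmetric] by (simp only: if_True)
  next
    case False
    then have "\<not> (\<exists>i<k. p < i * s)" using i0 by auto
    then have no: "\<not> (\<exists>i<k. p < i * s \<and> Q i)" for Q by blast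
    have "?L = not_within (F - {p + 1})"
    proof (rule Set.set_eqI)
      fix T show "T \<in> ?L \<longleftrightarrow> T \<in> not_within (F - {p + 1})"
        unfolding L using no by (auto simp: not_within_def)
    qed
    then show ?thesis using False unfolding i0_def[symmetric] by (simp only: if_False)
  qed
qed

text \<open>The first generator becomes redundant, and so does one starting at x_(p+2), since
  \<open>r \<le> p + m\<close> puts the adjoined monomial inside its window. For
  \<open>r = p + 1\<close> the adjoined monomial is 1.\<close>

lemma path_state_add:
  assumes "p < r" "r \<le> p + m"
  shows "path_state s m k F p r \<union> {T. {p + 2..r} \<subseteq> T}
    = (if p + 1 < r then path_state s m k F (p + 1) r else UNIV)"
proof -
  have eq: "{p + 2..r} \<subseteq> window s m i" if "p < i * s" "\<not> p + 1 < i * s" for i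
  proof -
    have "i * s = p + 1" using that by simp
    then show ?thesis using assms by (auto simp: window_def)
  qed
  have sub: "{p + 2..r} \<subseteq> {p + 1..r}" by auto
  have less: "path_state s m k F p r \<union> {T. {p + 2..r} \<subseteq> T} = path_state s m k F (p + 1) r"
    if "p + 1 < r"
  proof -
    have "{p + 1 + 1..r} = {p + 2..r}" by simp
    moreover have "p + 1 < i * s \<Longrightarrow> p < i * s" for i by simp
    ultimately show ?thesis unfolding path_state_def using eq sub by blast
  qed
  have "path_state s m k F p r \<union> {T. {p + 2..r} \<subseteq> T} = UNIV" if "\<not> p + 1 < r"
  proof -
    have "{p + 2..r} = {}" using that by simp
    then show ?thesis by auto
  qed
  then show ?thesis using less by (cases "p + 1 < r") (simp_all only: if_True if_False simp_thms)
qed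

text \<open>Induction on \<open>n - p\<close>. The colon branch takes one variable from
  \<open>F\<close> and either lowers \<open>path_codim\<close> by one or ends at a polynomial ring;
  the other branch keeps \<open>F\<close> and does not raise \<open>path_codim\<close>.\<close>

lemma wreg_path_state:
  assumes s: "s > 0" "s dvd m" and n: "n + s = k * s + m" "k \<ge> 1"
    and "p < r" "r \<le> p + m" "s dvd r" "r \<le> n" "F \<subseteq> {1..n}" "{p + 1..n} \<subseteq> F"
    and "d + path_codim s m n p r \<le> card F"
  shows "wreg (elem_syms n d :: 'a::field mpoly list) (monid (path_state s m k F p r))"
  using assms(5-)
proof (induction "n - p" arbitrary: p r F rule: less_induct)
  case less
  let ?Q = "m + s"
  let ?r' = "next_end s m p"
  let ?w = "{p + 2..r}"
  have p1: "p + 1 \<in> F" using less.prems by (auto simp: subset_iff)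
  have fin: "finite F" using less.prems finite_subset by auto
  have k: "p div s + 1 < k \<longleftrightarrow> ?r' \<le> n"
  proof -
    have "?r' \<le> n \<longleftrightarrow> (p div s + 1) * s + s \<le> k * s" using n by (auto simp: next_end_def)
    also have "\<dots> \<longleftrightarrow> (p div s + 2) * s \<le> k * s" by (simp add: algebra_simps)
    also have "\<dots> \<longleftrightarrow> p div s + 2 \<le> k" using s by (simp only: mult_le_cancel2) auto
    finally show ?thesis by auto
  qed
  obtain c where c: "r = c * s" using less.prems(3) by (metis dvd_div_mult_self)
  have "p div s + 1 \<le> c" using mult_gt_iff_ge_div[OF s(1), of p c] less.prems(1) c by simp
  then have r'_le: "?r' \<le> r + m" using c by (auto simp: next_end_def simp del: mult_Suc add_mult_distrib)
  have r'_gt: "p + 1 + m \<le> ?r'"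
  proof -
    have "p < (p div s + 1) * s" using mult_gt_iff_ge_div[OF s(1)] by blast
    then show ?thesis by (simp add: next_end_def)
  qed
  have Qr: "(n + ?Q - r) div ?Q = (n - r) div ?Q + 1"
  proof -
    have "n + ?Q - r = (n - r) + ?Q" using less.prems by simp
    then show ?thesis using s(1) by (simp only: div_add_self2[of ?Q] not_gr0)
  qed
  have colon: "wreg (elem_syms n d :: 'a mpoly list) (monid {T. T \<union> ?w \<in> path_state s m k F p r})"
  proof (cases "?r' \<le> n")
    case True
    \<comment> \<open>As \<open>s\<close> divides \<open>r\<close>, two colon steps move the end of
      the first generator by exactly \<open>m + s\<close>.\<close>
    have "r div s = c" using c s(1) by simp
    then have "next_end s m r = r + ?Q" using c by (simp add: next_end_def)
    then have "path_codim s m n r ?r' + 1 = path_codim s m n p r"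
      using Qr by (simp add: path_codim_def)
    then have "d + path_codim s m n r ?r' \<le> card (F - {p + 1})"
      using less.prems p1 fin by simp
    moreover have "s dvd ?r'" using s by (simp add: next_end_def)
    moreover have "{r + 1..n} \<subseteq> F - {p + 1}" using less.prems by (auto simp: subset_iff)
    moreover have "F - {p + 1} \<subseteq> {1..n}" using less.prems by auto
    moreover have "r < ?r'" using r'_gt less.prems by simp
    moreover have "n - r < n - p" using less.prems by simp
    ultimately have "wreg (elem_syms n d :: 'a mpoly list) (monid (path_state s m k (F - {p + 1}) r ?r'))"
      using less.hyps r'_le True by blast
    then show ?thesis
      using path_state_colon[of s p r m n F k] less.prems s k True by simp
  next
    case False
    \<comment> \<open>Since \<open>r \<le> n\<close>, \<open>path_codim\<close> is at least 1, which
      pays for the removed variable.\<close>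
    have "d \<le> card (F - {p + 1})"
      using less.prems p1 fin Qr by (simp add: path_codim_def)
    then have "wreg (elem_syms n d :: 'a mpoly list) (monid (not_within (F - {p + 1})))"
      using less.prems by (intro wreg_elem_syms_not_within) auto
    then show ?thesis
      using path_state_colon[of s p r m n F k] less.prems s k False by simp
  qed
  have add: "wreg (elem_syms n d :: 'a mpoly list) (monid (path_state s m k F p r \<union> {T. ?w \<subseteq> T}))"
  proof (cases "p + 1 < r")
    case True
    have "next_end s m p \<le> next_end s m (p + 1)"
      unfolding next_end_def by (intro add_right_mono mult_right_mono div_le_mono) auto
    then have "path_codim s m n (p + 1) r \<le> path_codim s m n p r"
      unfolding path_codim_def by (intro add_left_mono div_le_mono diff_le_mono2)
    then have "wreg (elem_syms n d :: 'a mpoly list) (monid (path_state s m k F (p + 1) r))"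
      using less.prems True by (intro less.hyps) auto
    then show ?thesis using path_state_add[of p r m s k F] less.prems True by simp
  next
    case False
    have "monid UNIV = (UNIV :: 'a mpoly set)" by (simp add: monid_def)
    then show ?thesis using path_state_add[of p r m s k F] less.prems False wreg_UNIV by simp
  qed
  show ?case by (rule wreg_monid_split[OF upset_path_state _ colon add]) simp
qed

text \<open>The initial state has \<open>p = 0\<close> and \<open>r = m\<close>: the first generator
  is x_1 ... x_m, and all others start beyond x_1.\<close>

lemma wreg_path_family:
  assumes s: "s > 0" "s dvd m" "m > 0" and n: "n + s = k * s + m" "k \<ge> 1"
    and d: "d + ((n + s) div (m + s) + n div (m + s)) \<le> n"
  shows "wreg (elem_syms n d :: 'a::field mpoly list) (monid (not_within {1..n} \<union> path_family s m k))"
proof -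
  have "1 * s \<le> k * s" using n(2) by (rule mult_le_mono1)
  then have mn: "m \<le> n" using n(1) by linarith
  have "0 < i * s \<longleftrightarrow> i \<noteq> 0" for i using s by simp
  then have "(\<exists>i<k. window s m i \<subseteq> S) \<longleftrightarrow> {1..m} \<subseteq> S \<or> (\<exists>i<k. 0 < i * s \<and> window s m i \<subseteq> S)" for S
    using n(2) by (metis One_nat_def Suc_le_eq add_0 mult_0 window_def)
  then have "path_state s m k {1..n} 0 m = not_within {1..n} \<union> path_family s m k"
    unfolding path_state_def path_family_def not_within_def by auto
  moreover have "path_codim s m n 0 m = (n + s) div (m + s) + n div (m + s)"
    by (simp add: path_codim_def next_end_def)
  then have "wreg (elem_syms n d :: 'a mpoly list) (monid (path_state s m k {1..n} 0 m))"
    using s n d mn by (intro wreg_path_state) auto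
  ultimately show ?thesis by simp
qed

section \<open>Koszul homology\<close>

text \<open>Pairs are removed one at a time; doubling the sum would not suffice in characteristic
  two.\<close>

lemma sum_involution_eq_0:
  fixes g :: "'i \<Rightarrow> 'b::ab_group_add"
  assumes "finite A" and "\<And>x. x \<in> A \<Longrightarrow> h x \<in> A" "\<And>x. x \<in> A \<Longrightarrow> h (h x) = x"
    "\<And>x. x \<in> A \<Longrightarrow> h x \<noteq> x" "\<And>x. x \<in> A \<Longrightarrow> g (h x) = - g x"
  shows "sum g A = 0"
  using assms
proof (induction "card A" arbitrary: A rule: less_induct)
  case less
  show ?case
  proof (cases "A = {}")
    case False
    then obtain x where x: "x \<in> A" by blast
    let ?B = "A - {x, h x}"
    have "sum g ?B = 0"
    proof (rule less.hyps)
      show "card ?B < card A" using less.prems(1) x by (intro psubset_card_mono) auto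
      show "h y \<in> ?B" if "y \<in> ?B" for y using that less.prems(2,3) x by (metis Diff_iff insert_iff empty_iff)
    qed (use less.prems in auto)
    moreover have "sum g A = sum g ?B + sum g {x, h x}"
      using less.prems(1,2) x by (intro sum.subset_diff) auto
    moreover have "x \<noteq> h x" using less.prems(4)[OF x] by simp
    ultimately show ?thesis using less.prems(5)[OF x] by simp
  qed simp
qed

text \<open>The sign that brings the exterior product of e_v and e_S into increasing order.\<close>

definition ksgn :: "nat \<Rightarrow> nat set \<Rightarrow> 'r::comm_ring_1" where
  "ksgn v S = (- 1) ^ card {u \<in> S. u < v}"

text \<open>A Koszul chain is given by its coefficients at the basis elements \<open>e\<^sub>S\<close>,
  where \<open>S\<close> ranges over the subsets of \<open>{1..n}\<close>.\<close>

definition kdiff :: "nat \<Rightarrow> (nat \<Rightarrow> 'r::comm_ring_1) \<Rightarrow> (nat set \<Rightarrow> 'r) \<Rightarrow> nat set \<Rightarrow> 'r" where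
  "kdiff n x z S = (\<Sum>v\<in>{1..n} - S. ksgn v S * x v * z (insert v S))"

text \<open>Left exterior multiplication by the 1-chain with coefficients \<open>g\<close>.\<close>

definition kwedge :: "(nat \<Rightarrow> 'r::comm_ring_1) \<Rightarrow> (nat set \<Rightarrow> 'r) \<Rightarrow> nat set \<Rightarrow> 'r" where
  "kwedge g z S = (\<Sum>u\<in>S. ksgn u (S - {u}) * g u * z (S - {u}))"

lemma ksgn_square: "ksgn v S * ksgn v S = 1"
  by (simp add: ksgn_def flip: power_mult_distrib)

lemma ksgn_insert:
  assumes "finite S" "v \<notin> S"
  shows "ksgn u (insert v S) = (if v < u then - ksgn u S else ksgn u S)"
proof (cases "v < u")
  case True
  then have "{w \<in> insert v S. w < u} = insert v {w \<in> S. w < u}" by auto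
  then show ?thesis using True assms by (simp add: ksgn_def)
next
  case False
  then have "{w \<in> insert v S. w < u} = {w \<in> S. w < u}" by auto
  then show ?thesis using False by (simp add: ksgn_def)
qed

lemma kdiff_kdiff:
  assumes "S \<subseteq> {1..n}"
  shows "kdiff n x (kdiff n x z) S = 0"
proof -
  have fin: "finite S" using assms finite_subset by auto
  define a where "a = (\<lambda>(v, u). ksgn v S * x v * (ksgn u (insert v S) * x u * z (insert u (insert v S))))"
  have "kdiff n x (kdiff n x z) S = (\<Sum>v\<in>{1..n} - S. \<Sum>u\<in>{1..n} - insert v S. a (v, u))"
    by (simp add: kdiff_def a_def sum_distrib_left)
  also have "\<dots> = sum a (SIGMA v:{1..n} - S. {1..n} - insert v S)"
    by (subst sum.Sigma) auto
  also have "\<dots> = 0"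
  proof (rule sum_involution_eq_0[where h = prod.swap])
    fix p assume "p \<in> (SIGMA v:{1..n} - S. {1..n} - insert v S)"
    then obtain v u where p: "p = (v, u)" "v \<notin> S" "u \<notin> S" "u \<noteq> v" by auto
    show "a (prod.swap p) = - a p"
      using p by (cases "u < v") (auto simp: a_def ksgn_insert[OF fin] insert_commute)
  qed (auto simp: insert_commute)
  finally show ?thesis .
qed

text \<open>The Koszul differential is an antiderivation. Terms in which the inserted and the
  removed index agree give the first summand; the others occur on both sides with opposite
  signs.\<close>

lemma kdiff_kwedge:
  assumes "S \<subseteq> {1..n}"
  shows "kdiff n x (kwedge g z) S = (\<Sum>v = 1..n. x v * g v) * z S - kwedge g (kdiff n x z) S"
proof -
  let ?N = "{1..n} - S"
  have fin: "finite S" using assms finite_subset by auto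
  define a where "a v u = ksgn v S * x v * (ksgn u (insert v (S - {u})) * g u * z (insert v (S - {u})))" for v u
  have 1: "ksgn v S * x v * kwedge g z (insert v S) = x v * g v * z S + (\<Sum>u\<in>S. a v u)"
    if v: "v \<in> ?N" for v
  proof -
    have "kwedge g z (insert v S) = ksgn v S * g v * z S
        + (\<Sum>u\<in>S. ksgn u (insert v S - {u}) * g u * z (insert v S - {u}))"
      using v fin by (simp add: kwedge_def)
    also have "(\<Sum>u\<in>S. ksgn u (insert v S - {u}) * g u * z (insert v S - {u}))
        = (\<Sum>u\<in>S. ksgn u (insert v (S - {u})) * g u * z (insert v (S - {u})))"
    proof (rule sum.cong)
      fix u assume "u \<in> S"
      then have "insert v S - {u} = insert v (S - {u})" using v by auto
      then show "ksgn u (insert v S - {u}) * g u * z (insert v S - {u})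
          = ksgn u (insert v (S - {u})) * g u * z (insert v (S - {u}))" by simp
    qed simp
    finally have "ksgn v S * x v * kwedge g z (insert v S)
        = (ksgn v S * ksgn v S) * (x v * g v * z S) + (\<Sum>u\<in>S. a v u)"
      by (simp add: a_def distrib_left sum_distrib_left mult_ac)
    then show ?thesis by (simp add: ksgn_square)
  qed
  have 2: "ksgn u (S - {u}) * g u * kdiff n x z (S - {u}) = x u * g u * z S - (\<Sum>v\<in>?N. a v u)"
    if u: "u \<in> S" for u
  proof -
    have S: "insert u (S - {u}) = S" and N: "{1..n} - (S - {u}) = insert u ?N" using u assms by auto
    have fin': "finite (S - {u})" using fin by simp
    \<comment> \<open>Interchanging the insertion of \<open>v\<close> with the removal of
      \<open>u\<close> reverses the sign.\<close>
    have "ksgn u (S - {u}) * g u * (ksgn v (S - {u}) * x v * z (insert v (S - {u}))) = - a v u"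
      if "v \<in> ?N" for v
    proof -
      have "v \<noteq> u" "v \<notin> S - {u}" "u \<notin> S - {u}" using that u by auto
      then show ?thesis
        using ksgn_insert[OF fin', of u v, where 'a = 'a] ksgn_insert[OF fin', of v u, where 'a = 'a] S
        by (cases "u < v") (auto simp: a_def)
    qed
    then have "(\<Sum>v\<in>?N. ksgn u (S - {u}) * g u * (ksgn v (S - {u}) * x v * z (insert v (S - {u}))))
        = - (\<Sum>v\<in>?N. a v u)" by (simp add: sum_negf)
    then have "ksgn u (S - {u}) * g u * kdiff n x z (S - {u})
        = (ksgn u (S - {u}) * ksgn u (S - {u})) * (x u * g u * z S) - (\<Sum>v\<in>?N. a v u)"
      using u S unfolding kdiff_def N by (simp add: distrib_left sum_distrib_left mult_ac)
    then show ?thesis by (simp add: ksgn_square)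
  qed
  have split: "{1..n} = ?N \<union> S" using assms by auto
  have "kdiff n x (kwedge g z) S = (\<Sum>v\<in>?N. x v * g v * z S) + (\<Sum>v\<in>?N. \<Sum>u\<in>S. a v u)"
    using 1 by (simp add: kdiff_def sum.distrib)
  moreover have "kwedge g (kdiff n x z) S = (\<Sum>u\<in>S. x u * g u * z S) - (\<Sum>u\<in>S. \<Sum>v\<in>?N. a v u)"
    using 2 by (simp add: kwedge_def sum_subtractf)
  moreover have "(\<Sum>u\<in>S. \<Sum>v\<in>?N. a v u) = (\<Sum>v\<in>?N. \<Sum>u\<in>S. a v u)" by (rule sum.swap)
  moreover have "(\<Sum>v = 1..n. x v * g v) * z S = (\<Sum>v\<in>?N. x v * g v * z S) + (\<Sum>u\<in>S. x u * g u * z S)"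
    using fin by (subst split, subst sum.union_disjoint) (auto simp: distrib_right sum_distrib_right)
  ultimately show ?thesis by simp
qed

section \<open>Koszul homology of subquotients over the subring with carrier
  \<open>C\<close>\<close>

definition submod :: "'r::comm_ring_1 set \<Rightarrow> 'r set \<Rightarrow> bool" where
  "submod C M \<longleftrightarrow> 0 \<in> M \<and> (\<forall>x\<in>M. \<forall>y\<in>M. x + y \<in> M) \<and> (\<forall>r\<in>C. \<forall>x\<in>M. r * x \<in> M)"

lemma submod_0: "submod C M \<Longrightarrow> 0 \<in> M"
  and submod_add: "submod C M \<Longrightarrow> x \<in> M \<Longrightarrow> y \<in> M \<Longrightarrow> x + y \<in> M"
  and submod_mult: "submod C M \<Longrightarrow> r \<in> C \<Longrightarrow> x \<in> M \<Longrightarrow> r * x \<in> M"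
  by (auto simp: submod_def)

lemma submod_uminus: "submod C M \<Longrightarrow> - 1 \<in> C \<Longrightarrow> x \<in> M \<Longrightarrow> - x \<in> M"
  using submod_mult[of C M "- 1" x] by simp

lemma submod_diff: "submod C M \<Longrightarrow> - 1 \<in> C \<Longrightarrow> x \<in> M \<Longrightarrow> y \<in> M \<Longrightarrow> x - y \<in> M"
  using submod_add[of C M x "- y"] submod_uminus[of C M y] by simp

lemma submod_sum: "submod C M \<Longrightarrow> (\<And>i. i \<in> A \<Longrightarrow> g i \<in> M) \<Longrightarrow> sum g A \<in> M"
  by (induction A rule: infinite_finite_induct) (auto simp: submod_0 submod_add)

lemma submod_ksgn: "submod C M \<Longrightarrow> - 1 \<in> C \<Longrightarrow> x \<in> M \<Longrightarrow> ksgn v S * x \<in> M"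
  using submod_uminus[of C M x] by (cases "even (card {u \<in> S. u < v})") (auto simp: ksgn_def)

lemma submod_kdiff:
  assumes "submod C M" "- 1 \<in> C" "\<And>v. v \<in> {1..n} \<Longrightarrow> x v \<in> C" "\<And>S. S \<subseteq> {1..n} \<Longrightarrow> z S \<in> M"
    and "S \<subseteq> {1..n}"
  shows "kdiff n x z S \<in> M"
  unfolding kdiff_def mult.assoc using assms
  by (intro submod_sum[OF assms(1)] submod_ksgn[OF assms(1)] submod_mult[OF assms(1)]) auto

lemma submod_kwedge:
  assumes "submod C M" "- 1 \<in> C" "\<And>v. v \<in> {1..n} \<Longrightarrow> g v \<in> C" "\<And>S. S \<subseteq> {1..n} \<Longrightarrow> z S \<in> M"
    and "S \<subseteq> {1..n}"
  shows "kwedge g z S \<in> M"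
  unfolding kwedge_def mult.assoc
proof (intro submod_sum[OF assms(1)] submod_ksgn[OF assms(1)] submod_mult[OF assms(1)] assms(2,3))
  show "z (S - {u}) \<in> M" for u using assms(5) by (intro assms(4)) auto
qed (use assms(5) in auto)

text \<open>The \<open>i\<close>-th Koszul homology of \<open>M/V\<close> with respect to \<open>x\<^sub>1, \<dots>, x\<^sub>n\<close> does not vanish.\<close>

definition koszul_nonzero :: "nat \<Rightarrow> (nat \<Rightarrow> 'r::comm_ring_1) \<Rightarrow> 'r set \<Rightarrow> nat \<Rightarrow> 'r set \<Rightarrow> bool" where
  "koszul_nonzero n x M i V \<longleftrightarrow>
    (\<exists>z. (\<forall>S. S \<subseteq> {1..n} \<longrightarrow> z S \<in> M) \<and> (\<forall>S. S \<subseteq> {1..n} \<and> card S \<noteq> i \<longrightarrow> z S = 0) \<and>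
      (\<forall>S. S \<subseteq> {1..n} \<longrightarrow> kdiff n x z S \<in> V) \<and>
      \<not> (\<exists>w. (\<forall>S. S \<subseteq> {1..n} \<longrightarrow> w S \<in> M) \<and> (\<forall>S. S \<subseteq> {1..n} \<longrightarrow> z S - kdiff n x w S \<in> V)))"

lemma koszul_nonzero_le:
  assumes "koszul_nonzero n x M i V" "0 \<in> M" "0 \<in> V"
  shows "i \<le> n"
proof (rule ccontr)
  assume "\<not> i \<le> n"
  obtain z where z: "\<forall>S. S \<subseteq> {1..n} \<and> card S \<noteq> i \<longrightarrow> z S = 0"
    "\<not> (\<exists>w. (\<forall>S. S \<subseteq> {1..n} \<longrightarrow> w S \<in> M) \<and> (\<forall>S. S \<subseteq> {1..n} \<longrightarrow> z S - kdiff n x w S \<in> V))"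
    using assms(1) by (auto simp: koszul_nonzero_def)
  have "z S = 0" if "S \<subseteq> {1..n}" for S
    using z(1) that card_mono[OF _ that] \<open>\<not> i \<le> n\<close> by fastforce
  then have "\<forall>S. S \<subseteq> {1..n} \<longrightarrow> z S - kdiff n x (\<lambda>_. 0) S \<in> V"
    using assms(3) by (simp add: kdiff_def)
  then show False using z(2) assms(2) by (auto dest!: spec[of _ "\<lambda>_. 0"])
qed

text \<open>The connecting homomorphism \<open>H\<^sub>i\<^sub>+\<^sub>1(N/fN) \<rightarrow> H\<^sub>i(N)\<close>, where \<open>N = M/V\<close>, is onto,
  because \<open>f\<close> annihilates Koszul homology.\<close>

lemma koszul_nonzero_step:
  assumes ob: "koszul_nonzero n x M i V"
    and M: "submod C M" and V: "submod C V" "V \<subseteq> M" and C: "- 1 \<in> C"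
    and x: "\<And>v. v \<in> {1..n} \<Longrightarrow> x v \<in> C" and g: "\<And>v. v \<in> {1..n} \<Longrightarrow> g v \<in> C"
    and f: "f = (\<Sum>v = 1..n. x v * g v)"
    and nzd: "\<And>y. y \<in> M \<Longrightarrow> f * y \<in> V \<Longrightarrow> y \<in> V"
  shows "koszul_nonzero n x M (Suc i) {a + f * b | a b. a \<in> V \<and> b \<in> M}"
proof -
  let ?W = "{a + f * b | a b. a \<in> V \<and> b \<in> M}"
  obtain z where z: "\<And>S. S \<subseteq> {1..n} \<Longrightarrow> z S \<in> M" "\<And>S. S \<subseteq> {1..n} \<Longrightarrow> card S \<noteq> i \<Longrightarrow> z S = 0"
      "\<And>S. S \<subseteq> {1..n} \<Longrightarrow> kdiff n x z S \<in> V"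
    and nb: "\<not> (\<exists>w. (\<forall>S. S \<subseteq> {1..n} \<longrightarrow> w S \<in> M) \<and> (\<forall>S. S \<subseteq> {1..n} \<longrightarrow> z S - kdiff n x w S \<in> V))"
    using ob unfolding koszul_nonzero_def by metis
  have key: "kdiff n x (kwedge g z) S = f * z S - kwedge g (kdiff n x z) S" if "S \<subseteq> {1..n}" for S
    using kdiff_kwedge[OF that] f by simp
  have wV: "kwedge g (kdiff n x z) S \<in> V" if "S \<subseteq> {1..n}" for S
    using submod_kwedge[OF V(1) C g z(3) that] .
  \<comment> \<open>The witness is \<open>kwedge g z\<close>: by \<open>key\<close> its boundary is
    \<open>f * z S\<close> up to an element of \<open>V\<close>.\<close>
  show ?thesis
    unfolding koszul_nonzero_def
  proof (intro exI[of _ "kwedge g z"] conjI allI impI)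
    fix S :: "nat set" assume S: "S \<subseteq> {1..n}"
    show "kwedge g z S \<in> M" using submod_kwedge[OF M C g z(1) S] .
    show "kdiff n x (kwedge g z) S \<in> ?W"
      using key[OF S] z(1)[OF S] submod_uminus[OF V(1) C wV[OF S]]
      by (intro CollectI exI[of _ "- kwedge g (kdiff n x z) S"] exI[of _ "z S"]) auto
  next
    fix S :: "nat set" assume S: "S \<subseteq> {1..n} \<and> card S \<noteq> Suc i"
    have "z (S - {u}) = 0" if u: "u \<in> S" for u
    proof (rule z(2))
      have "finite S" using S finite_subset by auto
      then have "card S = Suc (card (S - {u}))" using u by (rule card.remove)
      then show "card (S - {u}) \<noteq> i" using S by linarith
      show "S - {u} \<subseteq> {1..n}" using S by blast
    qed
    then have "ksgn u (S - {u}) * g u * z (S - {u}) = 0" if "u \<in> S" for u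
      using that by (simp only: mult_zero_right)
    then show "kwedge g z S = 0" unfolding kwedge_def by (intro sum.neutral ballI)
  next
    show "\<not> (\<exists>w. (\<forall>S. S \<subseteq> {1..n} \<longrightarrow> w S \<in> M) \<and>
        (\<forall>S. S \<subseteq> {1..n} \<longrightarrow> kwedge g z S - kdiff n x w S \<in> ?W))"
    proof
      assume "\<exists>w. (\<forall>S. S \<subseteq> {1..n} \<longrightarrow> w S \<in> M) \<and>
        (\<forall>S. S \<subseteq> {1..n} \<longrightarrow> kwedge g z S - kdiff n x w S \<in> ?W)"
      then obtain y where y: "\<And>S. S \<subseteq> {1..n} \<Longrightarrow> kwedge g z S - kdiff n x y S \<in> ?W"
        by blast
      have "\<forall>S\<in>Pow {1..n}. \<exists>p. kwedge g z S - kdiff n x y S = fst p + f * snd p \<and> fst p \<in> V \<and> snd p \<in> M"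
      proof
        fix S assume "S \<in> Pow {1..n}"
        then have "kwedge g z S - kdiff n x y S \<in> ?W" by (intro y) simp
        then obtain a b where "kwedge g z S - kdiff n x y S = a + f * b \<and> a \<in> V \<and> b \<in> M" by blast
        then show "\<exists>p. kwedge g z S - kdiff n x y S = fst p + f * snd p \<and> fst p \<in> V \<and> snd p \<in> M"
          by (intro exI[of _ "(a, b)"]) simp
      qed
      from bchoice[OF this] obtain p where p: "\<And>S. S \<subseteq> {1..n} \<Longrightarrow>
          kwedge g z S - kdiff n x y S = fst (p S) + f * snd (p S) \<and> fst (p S) \<in> V \<and> snd (p S) \<in> M"
        by blast
      define a b where "a S = fst (p S)" and "b S = snd (p S)" for S
      have ab: "kwedge g z S - kdiff n x y S = a S + f * b S" "a S \<in> V" "b S \<in> M" if "S \<subseteq> {1..n}" for S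
        using p[OF that] by (auto simp: a_def b_def)
      \<comment> \<open>Applying the differential to
        \<open>kwedge g z = kdiff n x y + a + f * b\<close> removes \<open>y\<close>. Comparison
        with \<open>key\<close> puts \<open>f\<close> times this difference into \<open>V\<close>,
        and \<open>f\<close> cancels; so \<open>z\<close> would be a boundary modulo
        \<open>V\<close>.\<close>
      have "z S - kdiff n x b S \<in> V" if S: "S \<subseteq> {1..n}" for S
      proof (rule nzd)
        show "z S - kdiff n x b S \<in> M"
          using submod_diff[OF M C z(1)[OF S] submod_kdiff[OF M C x ab(3) S]] .
        have "kdiff n x (kwedge g z) S = kdiff n x (\<lambda>T. kdiff n x y T + (a T + f * b T)) S"
          unfolding kdiff_def[of n x _ S]
          using S ab(1) by (intro sum.cong refl) (auto simp: algebra_simps)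
        also have "\<dots> = kdiff n x (kdiff n x y) S + kdiff n x a S + f * kdiff n x b S"
          by (simp add: kdiff_def[of n x _ S] distrib_left sum.distrib sum_distrib_left mult_ac)
        finally have "f * (z S - kdiff n x b S) = kdiff n x a S + kwedge g (kdiff n x z) S"
          using key[OF S] kdiff_kdiff[OF S, of x y] by (simp add: algebra_simps)
        then show "f * (z S - kdiff n x b S) \<in> V"
          using submod_add[OF V(1) submod_kdiff[OF V(1) C x ab(2) S] wV[OF S]] by simp
      qed
      then show False using nb ab(3) by blast
    qed
  qed
qed

section \<open>The polynomial ring in \<open>n\<close> variables\<close>

lemma carrier_mpoly_ring: "carrier (mpoly_ring n) = {p. \<forall>t\<in>supp p. supp t \<subseteq> {1..n}}"
  by (simp add: mpoly_ring_def)

lemma mpoly_ring_simps [simp]: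
  "x \<otimes>\<^bsub>mpoly_ring n\<^esub> y = x * y" "x \<oplus>\<^bsub>mpoly_ring n\<^esub> y = x + y"
  "\<zero>\<^bsub>mpoly_ring n\<^esub> = 0" "\<one>\<^bsub>mpoly_ring n\<^esub> = 1"
  by (simp_all add: mpoly_ring_def)

lemma ideal_module_simps [simp]:
  "carrier (ideal_module R I) = I" "x \<odot>\<^bsub>ideal_module R I\<^esub> y = x \<otimes>\<^bsub>R\<^esub> y"
  "x \<oplus>\<^bsub>ideal_module R I\<^esub> y = x \<oplus>\<^bsub>R\<^esub> y" "\<zero>\<^bsub>ideal_module R I\<^esub> = \<zero>\<^bsub>R\<^esub>"
  by (simp_all add: ideal_module_def)

lemma carrier_mpoly_ring_uminus: "p \<in> carrier (mpoly_ring n) \<Longrightarrow> - p \<in> carrier (mpoly_ring n)"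
  by (simp add: carrier_mpoly_ring in_keys_iff)

lemma a_inv_mpoly_ring:
  assumes "p \<in> carrier (mpoly_ring n :: 'a::field mpoly ring)"
  shows "\<ominus>\<^bsub>mpoly_ring n\<^esub> p = - p"
proof -
  interpret cring "mpoly_ring n :: 'a mpoly ring" by (rule cring_mpoly_ring)
  show ?thesis by (rule minus_equality) (use assms carrier_mpoly_ring_uminus in auto)
qed

lemma ideal_carrier_monid:
  assumes "upset U"
  shows "ideal (carrier (mpoly_ring n) \<inter> monid U) (mpoly_ring n :: 'a::field mpoly ring)"
proof -
  interpret cring "mpoly_ring n :: 'a mpoly ring" by (rule cring_mpoly_ring)
  note id = ring_ideal_monid[OF assms, where 'a = 'a]
  let ?I = "carrier (mpoly_ring n) \<inter> monid U :: 'a mpoly set"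
  show ?thesis
  proof (rule idealI)
    show "subgroup ?I (add_monoid (mpoly_ring n))"
    proof (rule subgroup.intro)
      fix x assume x: "x \<in> ?I"
      have "inv\<^bsub>add_monoid (mpoly_ring n)\<^esub> x = - x"
        using a_inv_mpoly_ring[of x n] x by (simp only: a_inv_def) blast
      then show "inv\<^bsub>add_monoid (mpoly_ring n)\<^esub> x \<in> ?I"
        using x carrier_mpoly_ring_uminus ring_ideal_uminus[OF id] by auto
    next
      fix x y assume "x \<in> ?I" "y \<in> ?I"
      then show "x \<otimes>\<^bsub>add_monoid (mpoly_ring n)\<^esub> y \<in> ?I"
        using a_closed[of x y] ring_ideal_add[OF id] by auto
    qed (use ring_ideal_0[OF id] zero_closed in auto)
  next
    fix a x :: "'a mpoly" assume "a \<in> ?I" "x \<in> carrier (mpoly_ring n)"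
    then show "x \<otimes>\<^bsub>mpoly_ring n\<^esub> a \<in> ?I" "a \<otimes>\<^bsub>mpoly_ring n\<^esub> x \<in> ?I"
      using m_closed[of x a] m_closed[of a x] ring_ideal_mult[OF id] ring_ideal_mult2[OF id] by auto
  qed (rule ring_axioms)
qed

lemma submod_ideal:
  assumes "ideal I (mpoly_ring n :: 'a::field mpoly ring)"
  shows "submod (carrier (mpoly_ring n)) I"
proof -
  interpret ideal I "mpoly_ring n :: 'a mpoly ring" by fact
  show ?thesis
    using additive_subgroup.a_closed[OF is_additive_subgroup] I_l_closed
      additive_subgroup.zero_closed[OF is_additive_subgroup]
    by (auto simp: submod_def)
qed

text \<open>Each monomial on the right is a multiple of some generator, and the cofactor again
  involves only the first \<open>n\<close> variables.\<close>

lemma genideal_sqm: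
  assumes "\<And>S. S \<in> G \<Longrightarrow> S \<subseteq> {1..n}"
  shows "genideal (mpoly_ring n) (sqm ` G)
    = (carrier (mpoly_ring n) \<inter> monid {T. \<exists>S\<in>G. S \<subseteq> T} :: 'a::field mpoly set)"
proof
  interpret cring "mpoly_ring n :: 'a mpoly ring" by (rule cring_mpoly_ring)
  have fin: "finite S" if "S \<in> G" for S using assms[OF that] finite_subset by blast
  have up: "upset {T. \<exists>S\<in>G. S \<subseteq> T}" by (auto simp: upset_def)
  have sub: "sqm ` G \<subseteq> (carrier (mpoly_ring n) \<inter> monid {T. \<exists>S\<in>G. S \<subseteq> T} :: 'a mpoly set)"
    using fin assms by (fastforce simp: carrier_mpoly_ring monid_def supp_sqm supp_ind)
  then show "genideal (mpoly_ring n) (sqm ` G) \<subseteq> (carrier (mpoly_ring n) \<inter> monid {T. \<exists>S\<in>G. S \<subseteq> T} :: 'a mpoly set)"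
    by (intro genideal_minimal ideal_carrier_monid up)
  have idl: "ideal (genideal (mpoly_ring n) (sqm ` G :: 'a mpoly set)) (mpoly_ring n)"
    using sub by (intro genideal_ideal) auto
  note sm = submod_ideal[OF idl]
  show "(carrier (mpoly_ring n) \<inter> monid {T. \<exists>S\<in>G. S \<subseteq> T} :: 'a mpoly set) \<subseteq> genideal (mpoly_ring n) (sqm ` G)"
  proof
    fix p :: "'a mpoly" assume p: "p \<in> carrier (mpoly_ring n) \<inter> monid {T. \<exists>S\<in>G. S \<subseteq> T}"
    have "Poly_Mapping.single t (coeff p t) \<in> genideal (mpoly_ring n) (sqm ` G)" if t: "t \<in> supp p" for t
    proof -
      obtain S where S: "S \<in> G" "S \<subseteq> supp t" using p t by (auto simp: monid_def)
      have "supp t \<subseteq> {1..n}" using p t by (auto simp: carrier_mpoly_ring)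
      moreover have "supp (t - ind S) \<subseteq> supp t" by (auto simp: in_keys_iff lookup_minus)
      ultimately have "Poly_Mapping.single (t - ind S) (coeff p t) \<in> carrier (mpoly_ring n)"
        by (auto simp: carrier_mpoly_ring)
      moreover have "sqm S \<in> genideal (mpoly_ring n) (sqm ` G :: 'a mpoly set)"
        using genideal_self[of "sqm ` G"] sub S by auto
      ultimately show ?thesis
        unfolding single_dvd_by_sqm[OF fin[OF S(1)] S(2)] mult.commute[of "sqm S"]
        by (intro submod_mult[OF sm])
    qed
    then show "p \<in> genideal (mpoly_ring n) (sqm ` G)"
      by (subst poly_mapping_sum_single[of p]) (intro submod_sum[OF sm])
  qed
qed

lemma irrelevant_ideal_eq:
  "irrelevant_ideal n = (carrier (mpoly_ring n) \<inter> monid {T. \<exists>v\<in>{1..n}. v \<in> T} :: 'a::field mpoly set)"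
proof -
  have "Var ` {1..n} = (sqm ` (\<lambda>v. {v}) ` {1..n} :: 'a mpoly set)"
    by (simp add: Var_eq_sqm image_image)
  then show ?thesis
    unfolding irrelevant_ideal_def by (simp only:) (subst genideal_sqm, auto)
qed

text \<open>Supplies the coefficients of the 1-chain in \<open>koszul_nonzero_step\<close>, which
  have to lie in the ring of \<open>n\<close> variables.\<close>

lemma irrelevant_ideal_expand:
  assumes "f \<in> (irrelevant_ideal n :: 'a::field mpoly set)"
  shows "\<exists>g. (\<forall>v. g v \<in> carrier (mpoly_ring n)) \<and> f = (\<Sum>v = 1..n. Var v * g v)"
proof -
  interpret cring "mpoly_ring n :: 'a mpoly ring" by (rule cring_mpoly_ring)
  let ?L = "{\<Sum>v = 1..n. Var v * g v | g. \<forall>v. g v \<in> carrier (mpoly_ring n)} :: 'a mpoly set"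
  have LI: "(\<forall>v. g v \<in> carrier (mpoly_ring n)) \<Longrightarrow> x = (\<Sum>v = 1..n. Var v * g v) \<Longrightarrow> x \<in> ?L" for g x
    by blast
  have "0 \<in> ?L" using zero_closed by (intro LI[of "\<lambda>_. 0"]) auto
  moreover have "x + y \<in> ?L" if xy: "x \<in> ?L" "y \<in> ?L" for x y
  proof -
    obtain g h where "\<forall>v. g v \<in> carrier (mpoly_ring n)" "\<forall>v. h v \<in> carrier (mpoly_ring n)"
      "x = (\<Sum>v = 1..n. Var v * g v)" "y = (\<Sum>v = 1..n. Var v * h v)" using xy by blast
    then show ?thesis
      using a_closed by (intro LI[of "\<lambda>v. g v + h v"]) (auto simp: distrib_left sum.distrib)
  qed
  moreover have "r * x \<in> ?L" if rx: "r \<in> carrier (mpoly_ring n)" "x \<in> ?L" for r x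
  proof -
    obtain g where g: "\<forall>v. g v \<in> carrier (mpoly_ring n)" "x = (\<Sum>v = 1..n. Var v * g v)"
      using rx by blast
    have "\<forall>v. r * g v \<in> carrier (mpoly_ring n)"
      using g(1) m_closed[OF rx(1)] by simp
    moreover have "r * x = (\<Sum>v = 1..n. Var v * (r * g v))"
      by (simp add: g(2) sum_distrib_left mult.left_commute)
    ultimately show ?thesis by (rule LI)
  qed
  ultimately have L: "submod (carrier (mpoly_ring n)) ?L" by (simp add: submod_def)
  have f: "f \<in> carrier (mpoly_ring n)" "f \<in> monid {T. \<exists>v\<in>{1..n}. v \<in> T}"
    using assms by (auto simp: irrelevant_ideal_eq)
  have "Poly_Mapping.single t (coeff f t) \<in> ?L" if t: "t \<in> supp f" for t
  proof -
    obtain v where v: "v \<in> {1..n}" "v \<in> supp t" using f t by (auto simp: monid_def)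
    let ?q = "Poly_Mapping.single (t - ind {v}) (coeff f t)"
    have "supp (t - ind {v}) \<subseteq> supp t" by (auto simp: in_keys_iff lookup_minus)
    then have "?q \<in> carrier (mpoly_ring n)" using f t by (auto simp: carrier_mpoly_ring)
    moreover have "Poly_Mapping.single t (coeff f t) = Var v * ?q"
      using single_dvd_by_sqm[of "{v}" t "coeff f t"] v by (simp add: Var_eq_sqm)
    moreover have "Var v * ?q = (\<Sum>u = 1..n. Var u * (if u = v then ?q else 0))"
      using v by (simp add: if_distrib[of "(*) _"] cong: if_cong)
    ultimately show ?thesis
      using zero_closed by (intro LI[of "\<lambda>u. if u = v then ?q else 0"]) auto
  qed
  then have "f \<in> ?L"
    by (subst poly_mapping_sum_single[of f]) (intro submod_sum[OF L])
  then show ?thesis by blast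
qed

lemma path_ideal_eq:
  assumes "n = k * (m - l) + l" "l \<le> m"
  shows "path_ideal n m l k = (carrier (mpoly_ring n) \<inter> monid (path_family (m - l) m k) :: 'a::field mpoly set)"
proof -
  let ?s = "m - l"
  have "path_monomial m l i = (sqm (window ?s m (i - 1)) :: 'a mpoly)" for i
  proof -
    have "window ?s m (i - 1) = (\<lambda>j. (i - 1) * ?s + j) ` {1..m}"
      unfolding window_def by (simp add: image_add_atLeastAtMost)
    then have "sqm (window ?s m (i - 1)) = (\<Prod>v\<in>(\<lambda>j. (i - 1) * ?s + j) ` {1..m}. Var v :: 'a mpoly)"
      by (simp add: prod_Var)
    then show ?thesis unfolding path_monomial_def by (subst (asm) prod.reindex) (auto simp: inj_on_def)
  qed
  then have "path_monomial m l ` {1..k} = (sqm ` (\<lambda>i. window ?s m (i - 1)) ` {1..k} :: 'a mpoly set)"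
    by (simp add: image_image)
  also have "(\<lambda>i. window ?s m (i - 1)) ` {1..k} = window ?s m ` {..<k}"
  proof -
    have "{1..k} = Suc ` {..<k}" by (simp only: image_Suc_lessThan)
    then show ?thesis by (simp only: image_image diff_Suc_1)
  qed
  finally have gens: "path_monomial m l ` {1..k} = (sqm ` window ?s m ` {..<k} :: 'a mpoly set)" .
  have win: "window ?s m i \<subseteq> {1..n}" if "i < k" for i
  proof -
    have "(i + 1) * ?s \<le> k * ?s" using that by (intro mult_le_mono1) simp
    then show ?thesis using assms by (auto simp: window_def)
  qed
  have "{T. \<exists>S\<in>window ?s m ` {..<k}. S \<subseteq> T} = path_family ?s m k"
    by (auto simp: path_family_def)
  then show ?thesis
    unfolding path_ideal_def gens using win by (subst genideal_sqm) auto
qed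

section \<open>Regular sequences expressed through \<open>lin\<close>\<close>

lemma lin_eq_sums:
  fixes M :: "'r::comm_ring_1 set"
  shows "lin fs M = {(\<Sum>i<length fs. fs ! i * v i) | v. v \<in> {..<length fs} \<rightarrow> M}"
proof (induction fs)
  case Nil
  show ?case by (auto intro: exI[of _ "\<lambda>_. 0"])
next
  case (Cons f fs)
  have "lin (f # fs) M = {f * a + (\<Sum>i<length fs. fs ! i * v i) | a v. a \<in> M \<and> v \<in> {..<length fs} \<rightarrow> M}"
    using Cons by auto
  also have "\<dots> = {(\<Sum>i<length (f # fs). (f # fs) ! i * v i) | v. v \<in> {..<length (f # fs)} \<rightarrow> M}"
    (is "?A = ?B")
  proof
    show "?A \<subseteq> ?B"
    proof
      fix x assume "x \<in> ?A"
      then obtain a v where av: "a \<in> M" "v \<in> {..<length fs} \<rightarrow> M" "x = f * a + (\<Sum>i<length fs. fs ! i * v i)"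
        by blast
      then have "x = (\<Sum>i<length (f # fs). (f # fs) ! i * case_nat a v i)"
        by (simp add: sum.lessThan_Suc_shift del: sum.lessThan_Suc)
      moreover have "case_nat a v \<in> {..<length (f # fs)} \<rightarrow> M"
        using av by (auto split: nat.split)
      ultimately show "x \<in> ?B" by blast
    qed
    show "?B \<subseteq> ?A"
    proof
      fix x assume "x \<in> ?B"
      then obtain v where v: "v \<in> {..<length (f # fs)} \<rightarrow> M" "x = (\<Sum>i<length (f # fs). (f # fs) ! i * v i)"
        by blast
      then have "x = f * v 0 + (\<Sum>i<length fs. fs ! i * v (Suc i))"
        by (simp add: sum.lessThan_Suc_shift del: sum.lessThan_Suc)
      moreover have "v 0 \<in> M" "(\<lambda>i. v (Suc i)) \<in> {..<length fs} \<rightarrow> M" using v(1) by auto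
      ultimately show "x \<in> ?A"
        by (intro CollectI exI[of _ "v 0"] exI[of _ "\<lambda>i. v (Suc i)"] conjI)
    qed
  qed
  finally show ?case .
qed

lemma seq_submodule_eq_lin:
  assumes I: "ideal I (mpoly_ring n :: 'a::field mpoly ring)" and fs: "set fs \<subseteq> carrier (mpoly_ring n)"
  shows "seq_submodule (mpoly_ring n) (ideal_module (mpoly_ring n) I) fs = lin fs I"
proof -
  interpret R: cring "mpoly_ring n :: 'a mpoly ring" by (rule cring_mpoly_ring)
  interpret M: Module.module "mpoly_ring n :: 'a mpoly ring" "ideal_module (mpoly_ring n) I"
    by (rule R.module_ideal_module[OF I])
  have fin: "finsum (ideal_module (mpoly_ring n) I) g A = sum g A" if "finite A" "g \<in> A \<rightarrow> I" for g :: "nat \<Rightarrow> _" and A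
    using that by (induction A rule: finite_induct) (auto simp: M.finsum_insert Pi_def)
  have "fs ! i * v i \<in> I" if "i < length fs" "v \<in> {..<length fs} \<rightarrow> I" for i v
    using submod_mult[OF submod_ideal[OF I], of "fs ! i" "v i"] subsetD[OF fs nth_mem[OF that(1)]] that
    by auto
  then have "(\<Oplus>\<^bsub>ideal_module (mpoly_ring n) I\<^esub>i\<in>{..<length fs}. fs ! i * v i) = (\<Sum>i<length fs. fs ! i * v i)"
    if "v \<in> {..<length fs} \<rightarrow> I" for v
    using that by (intro fin) auto
  then show ?thesis
    unfolding seq_submodule_def lin_eq_sums by (auto intro!: Collect_cong ex_cong1)
qed

lemma regular_sequence_iff:
  assumes I: "ideal I (mpoly_ring n :: 'a::field mpoly ring)"
  shows "regular_sequence (mpoly_ring n) (ideal_module (mpoly_ring n) I) fs \<longleftrightarrow>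
    set fs \<subseteq> carrier (mpoly_ring n) \<and>
    (\<forall>i<length fs. \<forall>x\<in>I. fs ! i * x \<in> lin (take i fs) I \<longrightarrow> x \<in> lin (take i fs) I) \<and>
    lin fs I \<noteq> I"
proof (cases "set fs \<subseteq> carrier (mpoly_ring n)")
  case True
  then have "set (take i fs) \<subseteq> carrier (mpoly_ring n)" for i using set_take_subset[of i fs] by blast
  then show ?thesis using True by (simp add: regular_sequence_def seq_submodule_eq_lin[OF I])
qed (simp add: regular_sequence_def)

section \<open>Regular sequences on an ideal\<close>

text \<open>Sets the variables outside \<open>{1..n}\<close> to zero. Weak regularity is proved in
  the ring of all variables; this projection, linear over the ring of \<open>n\<close> variables,
  carries the result back.\<close>

definition proj :: "nat \<Rightarrow> 'a::field mpoly \<Rightarrow> 'a mpoly" where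
  "proj n p = filt (\<lambda>t. supp t \<subseteq> {1..n}) p"

lemma proj_mult: "f \<in> carrier (mpoly_ring n) \<Longrightarrow> proj n (f * r) = f * proj n r"
  unfolding proj_def by (rule filt_mult) (auto simp: carrier_mpoly_ring supp_add_nat)

lemma proj_id: "p \<in> carrier (mpoly_ring n) \<Longrightarrow> proj n p = p"
  by (auto simp: proj_def carrier_mpoly_ring intro: filt_id)

lemma proj_mem: "p \<in> monid (not_within {1..n} \<union> U) \<Longrightarrow> proj n p \<in> carrier (mpoly_ring n) \<inter> monid U"
  by (auto simp: proj_def carrier_mpoly_ring monid_def not_within_def supp_filt)

lemma proj_lin:
  assumes "set fs \<subseteq> carrier (mpoly_ring n)" "proj n ` N \<subseteq> M" "x \<in> lin fs N"
  shows "proj n x \<in> lin fs M"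
  using assms(1,3)
proof (induction fs arbitrary: x)
  case Nil
  then show ?case using filt_zero[of "0 :: 'a mpoly"] by (simp add: proj_def)
next
  case (Cons f fs)
  then obtain a b where ab: "a \<in> N" "b \<in> lin fs N" "x = f * a + b" by auto
  have "proj n x = f * proj n a + proj n b"
    using Cons.prems(1) ab(3) proj_mult[of f n a] by (simp add: proj_def filt_add)
  then show ?case using Cons ab assms(2) by (intro lin_ConsI) auto
qed

text \<open>The point is that \<open>I \<inter> (gs) = (gs) I\<close> for every initial segment \<open>gs\<close> of \<open>es\<close>.\<close>

lemma regular_on_ideal:
  fixes es :: "'a::field mpoly list"
  assumes U: "upset U" and C: "set (es @ [g]) \<subseteq> carrier (mpoly_ring n)"
    and RI: "wreg es (monid (not_within {1..n} \<union> U))" and R: "wreg (es @ [g]) (monid (not_within {1..n}))"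
    and i: "i < length (es @ [g])" and x: "x \<in> carrier (mpoly_ring n) \<inter> monid U"
    and fx: "(es @ [g]) ! i * x \<in> lin (take i (es @ [g])) (carrier (mpoly_ring n) \<inter> monid U)"
  shows "x \<in> lin (take i (es @ [g])) (carrier (mpoly_ring n) \<inter> monid U)"
proof -
  let ?I = "carrier (mpoly_ring n) \<inter> monid U :: 'a mpoly set"
  let ?J = "monid (not_within {1..n} \<union> U) :: 'a mpoly set"
  let ?O = "monid (not_within {1..n}) :: 'a mpoly set"
  define f where "f = (es @ [g]) ! i"
  define gs where "gs = take i (es @ [g])"
  \<comment> \<open>This includes the last index, where \<open>f\<close> is \<open>g\<close>; thus
    \<open>g\<close> only has to be regular on the polynomial ring itself.\<close>
  have gs: "gs = take i es" using i by (simp add: gs_def)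
  have gsC: "set gs \<subseteq> carrier (mpoly_ring n)"
    using C set_take_subset[of i es] unfolding gs by auto
  have "es @ [g] = gs @ f # drop (Suc i) (es @ [g])"
    unfolding f_def gs_def using i by (rule id_take_nth_drop)
  then have nzd: "nzd_mod f (foldl adjoin ?O gs)"
    using R by (metis wreg_append wreg.simps(2))
  have "f * x \<in> lin gs UNIV"
    using fx lin_mono[of ?I UNIV gs] unfolding f_def gs_def by blast
  moreover have "0 \<in> ?O" by (simp add: monid_def)
  ultimately have "f * x \<in> foldl adjoin ?O gs" unfolding foldl_adjoin_eq by force
  then have "x \<in> foldl adjoin ?O gs" using nzd by (auto simp: nzd_mod_def colon_def)
  then obtain o' b where ob: "o' \<in> ?O" "b \<in> lin gs UNIV" "x = o' + b"
    unfolding foldl_adjoin_eq by blast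
  have "proj n o' = 0"
    using ob(1) unfolding proj_def by (intro filt_zero) (auto simp: monid_def not_within_def)
  then have "x = proj n b" using proj_id[of x n] x ob(3) by (simp add: proj_def filt_add)
  moreover have "proj n b \<in> lin gs UNIV" by (rule proj_lin[OF gsC _ ob(2)]) auto
  moreover have "x \<in> ?J" using x by (auto simp: monid_def)
  moreover have "wreg gs ?J" using RI wreg_append[of "take i es" "drop i es"] unfolding gs by simp
  moreover have "ring_ideal ?J" by (intro ring_ideal_monid upset_Un upset_not_within U)
  \<comment> \<open>Now \<open>x\<close> lies in both \<open>?J\<close> and (gs), hence in (gs)
    times \<open>?J\<close>; the projection turns \<open>?J\<close> into \<open>?I\<close>.\<close>
  ultimately have "x \<in> lin gs ?J" using wreg_Int_lin by blast
  moreover have "proj n ` ?J \<subseteq> ?I" using proj_mem by blast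
  ultimately have "proj n x \<in> lin gs ?I" by (intro proj_lin[OF gsC])
  then show ?thesis using proj_id[of x n] x by (simp add: gs_def)
qed

section \<open>Existence of a long regular sequence\<close>

lemma deg_ge_card: "card (supp t) \<le> deg t"
proof -
  have "deg t = (\<Sum>v\<in>supp t. coeff t v)"
    unfolding deg_def by (intro Sum_any.expand_superset) (auto simp: in_keys_iff)
  moreover have "card (supp t) \<le> (\<Sum>v\<in>supp t. coeff t v)"
    using sum_mono[of "supp t" "\<lambda>_. 1" "coeff t"] by (simp add: in_keys_iff Suc_le_eq)
  ultimately show ?thesis by simp
qed

text \<open>Shows that (fs)M differs from \<open>M\<close> once \<open>M\<close> contains an element
  with a term of the minimal degree \<open>d\<close>.\<close>

lemma lin_degree_gt:
  assumes "\<And>f t. f \<in> set fs \<Longrightarrow> t \<in> supp f \<Longrightarrow> 1 \<le> deg t"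
    and "\<And>p t. p \<in> M \<Longrightarrow> t \<in> supp p \<Longrightarrow> d \<le> deg t" and "p \<in> lin fs M" "t \<in> supp (p :: 'a::field mpoly)"
  shows "d < deg t"
  using assms(1,3,4)
proof (induction fs arbitrary: p)
  case (Cons f fs)
  then obtain a b where ab: "a \<in> M" "b \<in> lin fs M" "p = f * a + b" by auto
  then consider "t \<in> supp (f * a)" | "t \<in> supp b"
    using Cons.prems(3) Poly_Mapping.keys_add[of "f * a" b] by auto
  then show ?case
  proof cases
    case 1
    then obtain u v where "t = u + v" "u \<in> supp f" "v \<in> supp a" using keys_mult[of f a] by auto
    then show ?thesis using Cons.prems(1)[of f u] assms(2)[OF ab(1)] by (fastforce simp: deg_add)
  next
    case 2
    then show ?thesis using Cons ab by auto
  qed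
qed simp

lemma sqm_window_mem:
  assumes "i < k" "i * s + m \<le> n"
  shows "sqm (window s m i) \<in> (carrier (mpoly_ring n) \<inter> monid (path_family s m k) :: 'a::field mpoly set)"
proof -
  have "finite (window s m i)" "window s m i \<subseteq> {1..n}" using assms by (auto simp: window_def)
  then show ?thesis
    using assms(1) by (auto simp: carrier_mpoly_ring monid_def supp_sqm supp_ind path_family_def)
qed

lemma upset_path_family: "upset (path_family s m k)"
  unfolding upset_def path_family_def by blast

lemma elem_sym_mem:
  assumes "1 \<le> i"
  shows "elem_sym n i \<in> (irrelevant_ideal n :: 'a::field mpoly set)"
proof -
  have "supp t \<subseteq> {1..n} \<and> (\<exists>v\<in>{1..n}. v \<in> supp t)"
    if t: "t \<in> supp (elem_sym n i :: 'a mpoly)" for t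
  proof -
    obtain S where S: "S \<subseteq> {1..n}" "card S = i" "t = ind S" using supp_elem_sym[OF t] by blast
    then have "finite S" "S \<noteq> {}" using assms finite_subset by auto
    then show ?thesis using S by (auto simp: supp_ind)
  qed
  then show ?thesis by (auto simp: irrelevant_ideal_eq carrier_mpoly_ring monid_def)
qed

lemma regular_sequence_exists:
  assumes s: "s > 0" "s dvd m" "m > 0" and n: "n + s = k * s + m" "k \<ge> 1"
    and d: "d + ((n + s) div (m + s) + n div (m + s)) \<le> n" "d < n"
  shows "\<exists>fs. length fs = Suc d \<and> set fs \<subseteq> (irrelevant_ideal n :: 'a::field mpoly set) \<and>
    regular_sequence (mpoly_ring n)
      (ideal_module (mpoly_ring n) (carrier (mpoly_ring n) \<inter> monid (path_family s m k))) fs"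
proof -
  let ?I = "carrier (mpoly_ring n) \<inter> monid (path_family s m k) :: 'a mpoly set"
  let ?fs = "elem_syms n d @ [sqm {1}] :: 'a mpoly list"
  have irr: "set ?fs \<subseteq> irrelevant_ideal n"
  proof -
    have "set (elem_syms n d :: 'a mpoly list) \<subseteq> irrelevant_ideal n"
      unfolding set_elem_syms using elem_sym_mem[of _ n, where 'a = 'a] by (meson atLeastAtMost_iff image_subsetI)
    moreover have "sqm {1} \<in> (irrelevant_ideal n :: 'a mpoly set)"
      using d(2) by (auto simp: irrelevant_ideal_eq carrier_mpoly_ring monid_def supp_sqm supp_ind)
    ultimately show ?thesis by simp
  qed
  then have C: "set ?fs \<subseteq> carrier (mpoly_ring n)" by (auto simp: irrelevant_ideal_eq)
  have "1 * s \<le> k * s" using n(2) by (rule mult_le_mono1)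
  then have mn: "m \<le> n" using n(1) by linarith
  \<comment> \<open>The generator on the first window has degree \<open>m\<close>, whereas all terms
    in (fs)I have degree greater than \<open>m\<close>.\<close>
  have "lin ?fs ?I \<noteq> ?I"
  proof
    assume eq: "lin ?fs ?I = ?I"
    have "sqm (window s m 0) \<in> ?I" using sqm_window_mem[of 0 k s m n] n(2) mn by simp
    then have "sqm (window s m 0) \<in> lin ?fs ?I" unfolding eq .
    moreover have "1 \<le> deg t" if ft: "f \<in> set ?fs" "t \<in> supp f" for f t
    proof -
      have "supp t \<noteq> {}" using irr ft by (fastforce simp: irrelevant_ideal_eq monid_def)
      then have "1 \<le> card (supp t)" by (simp add: Suc_le_eq card_gt_0_iff)
      then show ?thesis using deg_ge_card[of t] by linarith
    qed
    moreover have "m \<le> deg t" if pt: "p \<in> ?I" "t \<in> supp p" for p t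
    proof -
      obtain i where "window s m i \<subseteq> supp t" using pt by (auto simp: monid_def path_family_def)
      then have "card (window s m i) \<le> card (supp t)" by (intro card_mono) auto
      then show ?thesis using deg_ge_card[of t] by (simp add: window_def)
    qed
    moreover have "ind (window s m 0) \<in> supp (sqm (window s m 0) :: 'a mpoly)" by (simp add: supp_sqm)
    ultimately have "m < deg (ind (window s m 0))"
      using lin_degree_gt[of ?fs ?I m "sqm (window s m 0)" "ind (window s m 0)"] by blast
    then show False by (simp add: deg_ind window_def)
  qed
  then have "regular_sequence (mpoly_ring n) (ideal_module (mpoly_ring n) ?I) ?fs"
    unfolding regular_sequence_iff[OF ideal_carrier_monid[OF upset_path_family]]
    using C regular_on_ideal[OF upset_path_family C wreg_path_family[OF s n d(1)] wreg_elem_syms_snoc[OF d(2)]]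
    by blast
  then show ?thesis using irr by (intro exI[of _ ?fs]) (simp add: length_elem_syms)
qed

text \<open>After \<open>j\<close> elements the Koszul homology in degree \<open>i + j\<close> is
  nonzero, and this degree cannot exceed \<open>n\<close>.\<close>

lemma regular_sequence_length_le:
  fixes fs :: "'a::field mpoly list"
  assumes kz: "koszul_nonzero n Var I i {0}" and I: "ideal I (mpoly_ring n)"
    and irr: "set fs \<subseteq> irrelevant_ideal n"
    and reg: "regular_sequence (mpoly_ring n) (ideal_module (mpoly_ring n) I) fs"
  shows "i + length fs \<le> n"
proof -
  let ?C = "carrier (mpoly_ring n) :: 'a mpoly set"
  note smI = submod_ideal[OF I]
  have C1: "- 1 \<in> ?C" using carrier_mpoly_ring_uminus[of 1 n] by (simp add: carrier_mpoly_ring)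
  have VarC: "Var v \<in> ?C" if "v \<in> {1..n}" for v using Var_in_mpoly_ring[OF that] .
  have sm: "submod ?C (lin gs I)" for gs
    using smI lin_zero[of I gs] lin_add[of I _ gs] lin_mult[of I _ _ gs] by (simp add: submod_def)
  have fsC: "set fs \<subseteq> ?C" and nzd: "\<And>j x. j < length fs \<Longrightarrow> x \<in> I \<Longrightarrow>
      fs ! j * x \<in> lin (take j fs) I \<Longrightarrow> x \<in> lin (take j fs) I"
    using reg unfolding regular_sequence_iff[OF I] by auto
  have sub: "lin gs I \<subseteq> I" if "set gs \<subseteq> ?C" for gs
    using that by (induction gs) (auto intro!: submod_0[OF smI] submod_add[OF smI] submod_mult[OF smI])
  have "koszul_nonzero n Var I (i + j) (lin (take j fs) I)" if "j \<le> length fs" for j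
    using that
  proof (induction j)
    case (Suc j)
    then have j: "j < length fs" by simp
    then obtain g where g: "\<forall>v. g v \<in> ?C" "fs ! j = (\<Sum>v = 1..n. Var v * g v)"
      using irrelevant_ideal_expand[of "fs ! j" n] irr nth_mem[OF j] by blast
    have "set (take j fs) \<subseteq> ?C" using fsC set_take_subset[of j fs] by blast
    then have "koszul_nonzero n Var I (Suc (i + j)) {a + fs ! j * b | a b. a \<in> lin (take j fs) I \<and> b \<in> I}"
      using Suc j g VarC nzd[OF j] sub
      by (intro koszul_nonzero_step[OF _ smI sm _ C1, where g = g]) auto
    then show ?case using j by (simp add: take_Suc_conv_app_nth lin_snoc)
  qed (use kz in simp)
  from this[of "length fs"] show ?thesis
    using koszul_nonzero_le[of n Var I "i + length fs" "lin fs I"] submod_0[OF smI] submod_0[OF sm, of fs]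
    by simp
qed

section \<open>A nonzero Koszul homology class\<close>

lemma coeff_ksgn_mult:
  "coeff (ksgn v S * p) t = ksgn v S * coeff (p :: 'k::cancel_comm_monoid_add \<Rightarrow>\<^sub>0 'b::comm_ring_1) t"
  by (cases "even (card {u \<in> S. u < v})") (simp_all add: ksgn_def lookup_uminus)

lemma coeff_Var_mult_ind:
  assumes "finite S"
  shows "coeff (Var v * p) (ind S) = (if v \<in> S then coeff (p :: 'a::field mpoly) (ind (S - {v})) else 0)"
proof (cases "v \<in> S")
  case True
  then have "ind S = Poly_Mapping.single v 1 + ind (S - {v})"
    using ind_insert[of "S - {v}" v] assms by (simp add: insert_absorb)
  then show ?thesis using True by (simp add: Var_def coeff_single_mult)
next
  case False
  have "ind S \<notin> supp (Var v * p)"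
  proof
    assume "ind S \<in> supp (Var v * p)"
    then obtain t where "ind S = Poly_Mapping.single v 1 + t" by (auto simp: Var_def supp_single_mult)
    then have "coeff (ind S) v = 1 + coeff t v" by (simp add: lookup_add)
    then show False using False assms by (simp add: coeff_ind)
  qed
  then show ?thesis using False by (simp add: in_keys_iff)
qed

text \<open>The variables are divided into consecutive groups by a monotone function \<open>c\<close>. The
  transversals of the groups \<open>1, \<dots>, K - 1\<close> define a linear functional on Koszul chains of
  degree \<open>K - 1\<close>; on a boundary, the terms in which some group other than \<open>0\<close> is
  met twice cancel in pairs.\<close>

definition transversals :: "nat \<Rightarrow> (nat \<Rightarrow> nat) \<Rightarrow> nat set \<Rightarrow> nat set set" where
  "transversals n c A = {S. S \<subseteq> {1..n} \<and> inj_on c S \<and> c ` S = A}"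

lemma finite_transversals: "finite (transversals n c A)"
  by (rule finite_subset[of _ "Pow {1..n}"]) (auto simp: transversals_def)

definition koszul_functional :: "nat \<Rightarrow> (nat \<Rightarrow> nat) \<Rightarrow> nat \<Rightarrow> (nat set \<Rightarrow> 'a::field mpoly) \<Rightarrow> 'a" where
  "koszul_functional n c K z =
    (\<Sum>S\<in>transversals n c {1..<K}. coeff (z S) (ind ({v \<in> {1..n}. c v < K} - S)))"

text \<open>Here \<open>u\<close> is the element of \<open>S\<close> in the group of
  \<open>v\<close>. Exchanging the two is the involution behind the cancellation below.\<close>

lemma transversal_exchange:
  assumes S: "S \<in> transversals n c A" and v: "v \<in> {1..n}" "v \<notin> S" "c v \<in> A"
  defines "u \<equiv> the_inv_into S c (c v)"
  shows "u \<in> S" "c u = c v" "insert v (S - {u}) \<in> transversals n c A"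
    "the_inv_into (insert v (S - {u})) c (c u) = v" "\<And>w. w \<in> S - {u} \<Longrightarrow> c w \<noteq> c v"
proof -
  have inj: "inj_on c S" and im: "c ` S = A" and sub: "S \<subseteq> {1..n}"
    using S by (auto simp: transversals_def)
  show u: "u \<in> S" unfolding u_def using inj im v(3) by (intro the_inv_into_into) auto
  show cu: "c u = c v" unfolding u_def using inj im v(3) by (intro f_the_inv_into_f) auto
  show ne: "c w \<noteq> c v" if "w \<in> S - {u}" for w
    using inj_onD[OF inj, of w u] that u cu by auto
  have inj': "inj_on c (insert v (S - {u}))"
    using inj_on_subset[OF inj, of "S - {u}"] ne by fastforce
  have "c ` insert v (S - {u}) = A" using u cu im by (metis image_insert insert_Diff)
  then show "insert v (S - {u}) \<in> transversals n c A"
    using inj' sub v(1) by (auto simp: transversals_def)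
  show "the_inv_into (insert v (S - {u})) c (c u) = v"
    unfolding cu using inj' by (intro the_inv_into_f_f) auto
qed

lemma koszul_functional_kdiff:
  fixes n :: nat and w :: "nat set \<Rightarrow> 'a::field mpoly"
  assumes c: "mono c" and K: "K \<ge> 1"
  defines "D \<equiv> {v \<in> {1..n}. c v < K}"
  shows "koszul_functional n c K (kdiff n Var w) =
    (\<Sum>S\<in>transversals n c {1..<K}. \<Sum>v\<in>{v \<in> {1..n}. c v = 0}. coeff (w (insert v S)) (ind (D - insert v S)))"
proof -
  let ?T = "transversals n c {1..<K}"
  let ?G = "{v \<in> {1..n}. c v = 0}"
  let ?H = "\<lambda>S. {v \<in> {1..n}. 1 \<le> c v \<and> c v < K} - S"
  define a where "a S v = coeff (w (insert v S)) (ind (D - insert v S))" for S v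
  have finD: "finite (D - S)" for S by (simp add: D_def)
  have cS: "1 \<le> c u" if "S \<in> ?T" "u \<in> S" for S u using that by (auto simp: transversals_def)
  have inner: "coeff (kdiff n Var w S) (ind (D - S)) = (\<Sum>v\<in>?G. a S v) + (\<Sum>v\<in>?H S. ksgn v S * a S v)"
    if S: "S \<in> ?T" for S
  proof -
    have "coeff (kdiff n Var w S) (ind (D - S))
        = (\<Sum>v\<in>{1..n} - S. ksgn v S * coeff (Var v * w (insert v S)) (ind (D - S)))"
      by (simp add: kdiff_def lookup_sum mult.assoc coeff_ksgn_mult)
    also have "\<dots> = (\<Sum>v\<in>{1..n} - S. if v \<in> D - S then ksgn v S * a S v else 0)"
    proof (intro sum.cong refl)
      fix v
      have "D - S - {v} = D - insert v S" by auto
      then show "ksgn v S * coeff (Var v * w (insert v S)) (ind (D - S))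
          = (if v \<in> D - S then ksgn v S * a S v else 0)"
        unfolding coeff_Var_mult_ind[OF finD] a_def by simp
    qed
    also have "\<dots> = (\<Sum>v\<in>D - S. ksgn v S * a S v)"
      by (intro sum.mono_neutral_cong_right) (auto simp: D_def)
    also have "\<dots> = (\<Sum>v\<in>?G \<union> ?H S. ksgn v S * a S v)"
    proof (rule sum.cong)
      have "v \<notin> S" if "c v = 0" for v using cS[OF S, of v] that by auto
      then show "D - S = ?G \<union> ?H S" using K by (auto simp: D_def)
    qed simp
    also have "(\<Sum>v\<in>?G \<union> ?H S. ksgn v S * a S v) = (\<Sum>v\<in>?G. ksgn v S * a S v) + (\<Sum>v\<in>?H S. ksgn v S * a S v)"
      by (intro sum.union_disjoint) auto
    also have "(\<Sum>v\<in>?G. ksgn v S * a S v) = (\<Sum>v\<in>?G. a S v)"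
    proof (rule sum.cong)
      fix v assume v: "v \<in> ?G"
      \<comment> \<open>Group 0 precedes the groups met by \<open>S\<close>, so \<open>v\<close>
        comes before all of \<open>S\<close> and the sign is 1.\<close>
      have "\<not> u < v" if "u \<in> S" for u
        using monoD[OF c, of u v] cS[OF S that] v by auto
      then have "{u \<in> S. u < v} = {}" by auto
      then have "ksgn v S = (1 :: 'a)" by (simp only: ksgn_def card.empty power_0)
      then show "ksgn v S * a S v = a S v" by simp
    qed simp
    finally show ?thesis .
  qed
  define h where "h = (\<lambda>(S, v). let u = the_inv_into S c (c v) in (insert v (S - {u}), u))"
  define g where "g = (\<lambda>(S, v). ksgn v S * a S v)"
  have "(\<Sum>S\<in>?T. \<Sum>v\<in>?H S. ksgn v S * a S v) = sum g (Sigma ?T ?H)"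
    using finite_transversals unfolding g_def by (subst sum.Sigma) auto
  also have "\<dots> = 0"
  proof (rule sum_involution_eq_0[where h = h])
    fix p assume "p \<in> Sigma ?T ?H"
    then obtain S v where p: "p = (S, v)" "S \<in> ?T" "v \<in> {1..n}" "v \<notin> S" "c v \<in> {1..<K}" by auto
    define u where "u = the_inv_into S c (c v)"
    note ex = transversal_exchange[OF p(2-5), folded u_def]
    have hp: "h (S, v) = (insert v (S - {u}), u)" by (simp add: h_def u_def Let_def)
    have uv: "u \<noteq> v" using ex(1) p(4) by auto
    have sub: "S \<subseteq> {1..n}" using p(2) by (simp add: transversals_def)
    then have fin: "finite (S - {u})" using finite_subset by auto
    show "h p \<in> Sigma ?T ?H"
      unfolding p(1) hp using ex(1-3) p(3,5) sub uv by auto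
    show "h (h p) = p"
    proof -
      have "insert u (insert v (S - {u}) - {v}) = S" using ex(1) p(4) by auto
      then show ?thesis unfolding p(1) hp by (simp add: h_def ex(4))
    qed
    show "h p \<noteq> p" unfolding p(1) hp using uv by simp
    have ins: "insert u (insert v (S - {u})) = insert v S" using ex(1) by auto
    \<comment> \<open>Groups are intervals because \<open>c\<close> is monotone, and no other
      element of \<open>S\<close> shares the group of \<open>u\<close> and \<open>v\<close>; so none
      lies between them. Hence the two terms of a pair have opposite signs.\<close>
    have "{x \<in> S - {u}. x < u} = {x \<in> S - {u}. x < v}"
    proof -
      have "x < u \<longleftrightarrow> x < v" if "x \<in> S - {u}" for x
        using ex(5)[OF that] ex(2) monoD[OF c, of x u] monoD[OF c, of x v]
          monoD[OF c, of u x] monoD[OF c, of v x] by linarith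
      then show ?thesis by auto
    qed
    then have eq: "ksgn u (S - {u}) = (ksgn v (S - {u}) :: 'a)" by (simp only: ksgn_def)
    have "ksgn v S = (if u < v then - ksgn v (S - {u}) else ksgn v (S - {u}) :: 'a)"
      using ksgn_insert[OF fin, of u v, where 'a = 'a] ex(1) by (simp add: insert_absorb)
    moreover have "ksgn u (insert v (S - {u})) = (if v < u then - ksgn v (S - {u}) else ksgn v (S - {u}) :: 'a)"
      using ksgn_insert[OF fin, of v u, where 'a = 'a] p(4) eq by simp
    moreover have "a (insert v (S - {u})) u = a S v" unfolding a_def ins ..
    ultimately show "g (h p) = - g p" using uv unfolding p(1) hp g_def by (cases "u < v") auto
  qed (auto simp: finite_transversals)
  finally have 0: "(\<Sum>S\<in>?T. \<Sum>v\<in>?H S. ksgn v S * a S v) = 0" .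
  have "koszul_functional n c K (kdiff n Var w) = (\<Sum>S\<in>?T. (\<Sum>v\<in>?G. a S v) + (\<Sum>v\<in>?H S. ksgn v S * a S v))"
    unfolding koszul_functional_def D_def[symmetric] using inner by (intro sum.cong refl)
  then show ?thesis using 0 by (simp add: sum.distrib a_def)
qed

text \<open>By \<open>CU\<close> the boundary of \<open>\<omega>\<close> has coefficients in the
  ideal. By \<open>T\<close> the functional vanishes on boundaries of chains with coefficients in
  the ideal, but it takes the value 1 on the boundary of \<open>\<omega>\<close>.\<close>

lemma koszul_nonzero_monid:
  fixes n :: nat
  assumes c: "mono c" and K: "K \<ge> 1" and U: "upset U"
  defines "D \<equiv> {v \<in> {1..n}. c v < K}"
  assumes C: "C \<in> transversals n c {0..<K}" and CU: "\<And>v. v \<in> C \<Longrightarrow> insert v (D - C) \<in> U"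
    and T: "\<And>T. T \<in> transversals n c {0..<K} \<Longrightarrow> D - T \<notin> U"
  shows "koszul_nonzero n Var (carrier (mpoly_ring n) \<inter> monid U :: 'a::field mpoly set) (K - 1) {0}"
proof -
  let ?I = "carrier (mpoly_ring n) \<inter> monid U :: 'a mpoly set"
  let ?R = "carrier (mpoly_ring n) :: 'a mpoly set"
  let ?T = "transversals n c {1..<K}"
  let ?G = "{v \<in> {1..n}. c v = 0}"
  define \<omega> where "\<omega> S = (if S = C then sqm (D - C) else 0 :: 'a mpoly)" for S
  have smI: "submod ?R ?I" by (rule submod_ideal[OF ideal_carrier_monid[OF U]])
  have C1: "- 1 \<in> ?R" using carrier_mpoly_ring_uminus[of 1 n] by (simp add: carrier_mpoly_ring)
  have Csub: "C \<subseteq> {1..n}" and Cinj: "inj_on c C" and Cim: "c ` C = {0..<K}"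
    using C by (auto simp: transversals_def)
  have finC: "finite C" using Csub finite_subset by auto
  have cardC: "card C = K" using card_image[OF Cinj] Cim by simp
  have finD: "finite D" by (simp add: D_def)
  have zI: "kdiff n Var \<omega> S \<in> ?I" for S
    unfolding kdiff_def mult.assoc
  proof (intro submod_sum[OF smI] submod_ksgn[OF smI C1])
    fix v assume v: "v \<in> {1..n} - S"
    show "Var v * \<omega> (insert v S) \<in> ?I"
    proof (cases "insert v S = C")
      case True
      then have vC: "v \<in> C" by auto
      have "Var v * \<omega> (insert v S) = sqm (insert v (D - C))"
        using True vC finD by (simp add: \<omega>_def sqm_insert)
      moreover have "insert v (D - C) \<subseteq> {1..n}" using v by (auto simp: D_def)
      ultimately show ?thesis
        using CU[OF vC] finD by (auto simp: carrier_mpoly_ring monid_def supp_sqm supp_ind)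
    next
      case False
      then show ?thesis using submod_0[OF smI] by (simp add: \<omega>_def)
    qed
  qed
  have z0: "kdiff n Var \<omega> S = 0" if "card S \<noteq> K - 1" "S \<subseteq> {1..n}" for S
    unfolding kdiff_def
  proof (intro sum.neutral ballI)
    fix v assume v: "v \<in> {1..n} - S"
    have "finite S" using that(2) finite_subset by auto
    then have "insert v S \<noteq> C" using cardC that(1) v by auto
    then show "ksgn v S * Var v * \<omega> (insert v S) = 0" by (simp add: \<omega>_def)
  qed
  have "\<not> (\<exists>w. (\<forall>S. S \<subseteq> {1..n} \<longrightarrow> w S \<in> ?I) \<and>
      (\<forall>S. S \<subseteq> {1..n} \<longrightarrow> kdiff n Var \<omega> S - kdiff n Var w S \<in> {0}))"
  proof
    assume "\<exists>w. (\<forall>S. S \<subseteq> {1..n} \<longrightarrow> w S \<in> ?I) \<and>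
      (\<forall>S. S \<subseteq> {1..n} \<longrightarrow> kdiff n Var \<omega> S - kdiff n Var w S \<in> {0})"
    then obtain w where w: "\<And>S. S \<subseteq> {1..n} \<Longrightarrow> w S \<in> ?I"
      "\<And>S. S \<subseteq> {1..n} \<Longrightarrow> kdiff n Var \<omega> S = kdiff n Var w S" by auto
    have ext: "insert v S \<in> transversals n c {0..<K}" if Sv: "S \<in> ?T" "v \<in> ?G" for S v
    proof -
      have S: "S \<subseteq> {1..n}" "inj_on c S" "c ` S = {1..<K}" and v: "v \<in> {1..n}" "c v = 0"
        using Sv by (auto simp: transversals_def)
      have "insert 0 {1..<K} = {0..<K}" using K by auto
      then have "c ` insert v S = {0..<K}" using S(3) v(2) by simp
      moreover have "inj_on c (insert v S)"
      proof -
        have "c v \<notin> c ` (S - {v})"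
        proof
          assume "c v \<in> c ` (S - {v})"
          then have "c v \<in> c ` S" by blast
          then show False unfolding S(3) v(2) by simp
        qed
        then show ?thesis using S(2) by (simp add: inj_on_insert)
      qed
      ultimately show ?thesis using S(1) v(1) by (simp add: transversals_def)
    qed
    have "koszul_functional n c K (kdiff n Var \<omega>) = koszul_functional n c K (kdiff n Var w)"
      unfolding koszul_functional_def using w(2) by (intro sum.cong refl) (simp add: transversals_def)
    also have "\<dots> = 0"
      unfolding koszul_functional_kdiff[OF c K]
    proof (intro sum.neutral ballI)
      fix S v assume "S \<in> ?T" "v \<in> ?G"
      then have tr: "insert v S \<in> transversals n c {0..<K}" by (rule ext)
      then have "w (insert v S) \<in> monid U" using w(1)[of "insert v S"] by (auto simp: transversals_def)
      moreover have "supp (ind (D - insert v S)) = D - insert v S" using finD by (intro supp_ind) simp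
      ultimately have "ind (D - insert v S) \<notin> supp (w (insert v S))"
        using T[OF tr] unfolding monid_def by force
      then show "coeff (w (insert v S)) (ind ({v \<in> {1..n}. c v < K} - insert v S)) = 0"
        unfolding D_def[symmetric] by (simp add: in_keys_iff)
    qed
    also have "koszul_functional n c K (kdiff n Var \<omega>) = 1"
    proof -
      have "0 \<in> c ` C" using K Cim by simp
      \<comment> \<open>With \<open>v0\<close> the element of \<open>C\<close> in group 0, the only
        surviving term belongs to the transversal \<open>C - {v0}\<close> and the variable
        \<open>v0\<close>.\<close>
      then obtain v0 where v0: "v0 \<in> C" "c v0 = 0" by (metis imageE)
      have C': "C - {v0} \<in> ?T"
      proof -
        have "c ` (C - {v0}) = c ` C - {c v0}" using Cinj v0(1) by (auto simp: inj_on_def)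
        then show ?thesis
          using Csub Cim v0 inj_on_subset[OF Cinj, of "C - {v0}"] by (auto simp: transversals_def)
      qed
      have eq: "coeff (\<omega> (insert v S)) (ind (D - insert v S)) = (if v = v0 then if S = C - {v0} then 1 else 0 else 0)"
        if S: "S \<in> ?T" and v: "v \<in> ?G" for S v
      proof (cases "insert v S = C")
        case True
        have "v = v0" using True v v0 inj_onD[OF Cinj, of v v0] by auto
        moreover have "v \<notin> S"
        proof
          assume "v \<in> S"
          then have "c v \<in> c ` S" by blast
          moreover have "c ` S = {1..<K}" using S by (simp add: transversals_def)
          ultimately show False using v by simp
        qed
        then have "S = C - {v}" using True by blast
        ultimately show ?thesis unfolding True by (simp add: \<omega>_def sqm_def)
      next
        case False
        then have "\<not> (v = v0 \<and> S = C - {v0})" using v0 by auto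
        then show ?thesis using False by (auto simp: \<omega>_def)
      qed
      have v0G: "v0 \<in> ?G" using v0 Csub by auto
      have "koszul_functional n c K (kdiff n Var \<omega>)
        = (\<Sum>S\<in>?T. \<Sum>v\<in>?G. if v = v0 then if S = C - {v0} then 1 else 0 else 0)"
        unfolding koszul_functional_kdiff[OF c K] D_def[symmetric] using eq by (intro sum.cong refl)
      also have "\<dots> = 1"
        using v0G C' by (simp add: finite_transversals)
      finally show ?thesis .
    qed
    finally show False by simp
  qed
  then show ?thesis
    unfolding koszul_nonzero_def using zI z0 kdiff_kdiff[of _ n Var \<omega>]
    by (intro exI[of _ "kdiff n Var \<omega>"]) auto
qed

section \<open>The depth of the path ideal\<close>

text \<open>The groups alternate in length between \<open>m\<close> and \<open>s\<close>, where \<open>s = m - l\<close>.\<close>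

definition path_group :: "nat \<Rightarrow> nat \<Rightarrow> nat \<Rightarrow> nat" where
  "path_group s m v = 2 * ((v - 1) div (m + s)) + (if (v - 1) mod (m + s) < m then 0 else 1)"

lemma mono_path_group: "mono (path_group s m)"
proof
  fix v w :: nat assume "v \<le> w"
  then have le: "v - 1 \<le> w - 1" by simp
  then have "(v - 1) div (m + s) \<le> (w - 1) div (m + s)" by (rule div_le_mono)
  moreover have "(v - 1) mod (m + s) \<le> (w - 1) mod (m + s)"
    if "(v - 1) div (m + s) = (w - 1) div (m + s)"
    using le that div_mult_mod_eq[of "v - 1" "m + s"] div_mult_mod_eq[of "w - 1" "m + s"]
    by (metis add_le_cancel_left)
  ultimately show "path_group s m v \<le> path_group s m w"
    unfolding path_group_def by (cases "(v - 1) div (m + s) = (w - 1) div (m + s)") auto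
qed

lemma path_group_eq:
  assumes "r < m + s"
  shows "path_group s m (q * (m + s) + r + 1) = 2 * q + (if r < m then 0 else 1)"
proof -
  have "(q * Q + r) div Q = q" "(q * Q + r) mod Q = r" if "r < Q" for Q :: nat
    using that by simp_all
  from this[OF assms] show ?thesis by (simp only: path_group_def add_diff_cancel_right')
qed

lemma path_groupD:
  assumes "path_group s m v = g"
  shows "(v - 1) div (m + s) = g div 2 \<and> ((v - 1) mod (m + s) < m \<longleftrightarrow> even g)"
proof -
  have "x = (2 * x + (if b then 0 else 1)) div 2 \<and> (b \<longleftrightarrow> even (2 * x + (if b then 0 else 1 :: nat)))" for x b
    by auto
  then show ?thesis unfolding assms[symmetric] path_group_def .
qed

text \<open>Group 2q is complete iff q(m+s) + m is at most \<open>n\<close>, and group 2q+1 iff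
  (q+1)(m+s) is; so \<open>K\<close> counts the complete groups. Any window inside them contains a
  whole group and hence meets every transversal.\<close>

lemma koszul_nonzero_path:
  assumes s: "s > 0" "s dvd m" "m > 0" and n: "n + s = k * s + m" "k \<ge> 1"
  defines "K \<equiv> (n + s) div (m + s) + n div (m + s)"
  shows "koszul_nonzero n Var (carrier (mpoly_ring n) \<inter> monid (path_family s m k) :: 'a::field mpoly set) (K - 1) {0}"
    and "1 \<le> K" "K \<le> n"
proof -
  let ?Q = "m + s" and ?c = "path_group s m"
  let ?D = "{v \<in> {1..n}. ?c v < K}"
  have "1 * s \<le> k * s" using n(2) by (rule mult_le_mono1)
  then have mn: "m \<le> n" using n(1) by linarith
  have Q: "?Q > 0" using s by simp
  have win_k: "i < k" if "i * s + m \<le> n" for i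
  proof -
    have "(i + 1) * s \<le> k * s" using that n(1) by simp
    then have "i + 1 \<le> k" using s(1) by (simp only: mult_le_cancel2)
    then show ?thesis by simp
  qed
  \<comment> \<open>The two counts differ by at most one, so the complete groups are exactly those
    with index below \<open>K\<close>.\<close>
  have div_le: "n div ?Q \<le> (n + s) div ?Q" "(n + s) div ?Q \<le> n div ?Q + 1"
  proof -
    show "n div ?Q \<le> (n + s) div ?Q" by (rule div_le_mono) simp
    have "(n + s) div ?Q \<le> (n + ?Q) div ?Q" by (rule div_le_mono) simp
    then show "(n + s) div ?Q \<le> n div ?Q + 1" using Q by (simp only: div_add_self2)
  qed
  have even_le: "q * ?Q + m \<le> n" if "2 * q < K" for q
  proof -
    have "q + 1 \<le> (n + s) div ?Q" using that div_le unfolding K_def by linarith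
    then have "(q + 1) * ?Q \<le> n + s" using Q by (simp only: less_eq_div_iff_mult_less_eq)
    then show ?thesis by simp
  qed
  have odd_le: "q * ?Q + ?Q \<le> n" if "2 * q + 1 < K" for q
  proof -
    have "q + 1 \<le> n div ?Q" using that div_le unfolding K_def by linarith
    then have "(q + 1) * ?Q \<le> n" using Q by (simp only: less_eq_div_iff_mult_less_eq)
    then show ?thesis by simp
  qed
  \<comment> \<open>The first variable of each group of length \<open>m\<close>, and the last
    variable of each group of length \<open>s\<close>.\<close>
  define p where "p j = (j div 2) * ?Q + (if even j then 0 else ?Q - 1) + 1" for j
  have cp: "?c (p j) = j" for j
    using s path_group_eq[of 0 m s "j div 2"] path_group_eq[of "?Q - 1" m s "j div 2"]
    by (cases "even j") (auto simp: p_def)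
  define C where "C = p ` {0..<K}"
  have pn: "p j \<in> {1..n}" if "j < K" for j
  proof (cases "even j")
    case True
    then show ?thesis using even_le[of "j div 2"] that s by (auto simp: p_def)
  next
    case False
    then have "2 * (j div 2) + 1 = j" by simp
    then show ?thesis using odd_le[of "j div 2"] that s False by (auto simp: p_def)
  qed
  have Ctr: "C \<in> transversals n ?c {0..<K}"
    unfolding transversals_def C_def using pn by (auto simp: cp image_image inj_on_def)
  have CI: "w = p (?c w)" if "w \<in> C" for w using that by (auto simp: C_def cp)
  show "1 \<le> K"
  proof -
    have "?Q div ?Q \<le> (n + s) div ?Q" using mn by (intro div_le_mono) simp
    then show ?thesis using Q unfolding K_def by simp
  qed
  have "card C = K" unfolding C_def by (subst card_image) (auto intro: inj_on_inverseI[of _ ?c] simp: cp)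
  moreover have "card C \<le> card {1..n}" using Ctr by (intro card_mono) (auto simp: transversals_def)
  ultimately show "K \<le> n" by simp
  have cw: "?c w = 2 * q + (if w \<le> q * ?Q + m then 0 else 1)" if "w \<in> {q * ?Q + 1..q * ?Q + ?Q}" for w q
    using path_group_eq[of "w - 1 - q * ?Q" m s q] that by auto
  have CU: "insert v (?D - C) \<in> path_family s m k" if v: "v \<in> C" for v
  proof -
    obtain j where j: "j < K" "v = p j" using v by (auto simp: C_def)
    define q where "q = j div 2"
    \<comment> \<open>A group of length \<open>m\<close> is itself a window. For a group of length
      \<open>s\<close>, the window ending with it is taken; this misses the chosen first variable of
      the preceding group.\<close>
    obtain i where i: "i < k" "window s m i \<subseteq> ?D" "\<And>w. w \<in> window s m i \<Longrightarrow> w \<in> C \<Longrightarrow> w = v"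
    proof (cases "even j")
      case True
      then have j2: "j = 2 * q" by (simp add: q_def)
      have le: "q * ?Q + m \<le> n" using even_le j j2 by simp
      obtain b where "?Q = b * s" using s(2) by (metis dvd_add_triv_right_iff dvd_div_mult_self)
      then have b: "q * b * s = q * ?Q" by simp
      have win: "window s m (q * b) = {q * ?Q + 1..q * ?Q + m}" unfolding window_def b ..
      have c: "?c w = j" if "w \<in> window s m (q * b)" for w using cw[of w q] that unfolding win j2 by auto
      show ?thesis
      proof (rule that[of "q * b"])
        show "q * b < k" using win_k[of "q * b"] le b by simp
        show "window s m (q * b) \<subseteq> ?D" using c j le by (auto simp: win)
        show "w = v" if "w \<in> window s m (q * b)" "w \<in> C" for w
          using CI[OF that(2)] c[OF that(1)] j(2) by simp
      qed
    next
      case False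
      then have j2: "j = 2 * q + 1" by (simp add: q_def)
      have le: "q * ?Q + ?Q \<le> n" using odd_le j j2 by simp
      obtain b where "?Q = b * s" using s(2) by (metis dvd_add_triv_right_iff dvd_div_mult_self)
      then have b: "(q * b + 1) * s = q * ?Q + s" by (simp add: add_mult_distrib)
      have win: "window s m (q * b + 1) = {q * ?Q + s + 1..q * ?Q + ?Q}"
        unfolding window_def b by simp
      have c: "?c w \<in> {2 * q, j}" if "w \<in> window s m (q * b + 1)" for w
        using cw[of w q] that unfolding win j2 by auto
      have "p (2 * q) = q * ?Q + 1" by (simp add: p_def)
      then have np: "p (2 * q) \<notin> window s m (q * b + 1)" using s(1) unfolding win by simp
      show ?thesis
      proof (rule that[of "q * b + 1"])
        have "(q * b + 1) * s + m \<le> n" unfolding b using le by simp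
        then show "q * b + 1 < k" by (rule win_k)
        show "window s m (q * b + 1) \<subseteq> ?D"
        proof
          fix w assume w: "w \<in> window s m (q * b + 1)"
          then have "?c w < K" using c[OF w] j(1) j2 by auto
          moreover have "w \<in> {1..n}" using w le unfolding win by simp
          ultimately show "w \<in> ?D" by simp
        qed
        show "w = v" if "w \<in> window s m (q * b + 1)" "w \<in> C" for w
          using CI[OF that(2)] c[OF that(1)] np j(2) that(1) by auto
      qed
    qed
    then show ?thesis unfolding path_family_def by blast
  qed
  have TU: "?D - T \<notin> path_family s m k" if T: "T \<in> transversals n ?c {0..<K}" for T
  proof
    assume "?D - T \<in> path_family s m k"
    then obtain i where i: "window s m i \<subseteq> ?D - T" by (auto simp: path_family_def)
    define q r where "q = i * s div ?Q" and "r = i * s mod ?Q"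
    have i_eq: "i * s = q * ?Q + r" unfolding q_def r_def by (rule div_mult_mod_eq[symmetric])
    have r: "r < ?Q" using Q by (simp add: r_def)
    have hit: False if g: "g < K" "\<And>v. ?c v = g \<Longrightarrow> v \<in> {1..n} \<Longrightarrow> v \<in> window s m i" for g
    proof -
      have "g \<in> ?c ` T" using T g(1) by (simp add: transversals_def)
      then obtain v where v: "v \<in> T" "?c v = g" by blast
      then have "v \<in> {1..n}" using T by (auto simp: transversals_def)
      then have "v \<in> window s m i" using v(2) by (intro g(2))
      then show False using i v(1) by blast
    qed
    have vq: "v - 1 = (v - 1) div ?Q * ?Q + (v - 1) mod ?Q" "(v - 1) mod ?Q < ?Q" for v
      by (rule div_mult_mod_eq[symmetric]) (use Q in simp)
    show False
    proof (cases "r = 0")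
      case True
      have "q * ?Q + 1 \<in> window s m i" using s True by (simp add: window_def i_eq)
      moreover have "?c (q * ?Q + 1) = 2 * q" using cw[of "q * ?Q + 1" q] s by simp
      ultimately have "2 * q < K" using i by force
      moreover have "v \<in> window s m i" if "?c v = 2 * q" "v \<in> {1..n}" for v
      proof -
        have "(v - 1) div ?Q = q \<and> (v - 1) mod ?Q < m"
          using path_groupD[OF that(1)] by auto
        then show ?thesis using vq[of v] that(2) True by (auto simp: window_def i_eq)
      qed
      ultimately show False by (rule hit)
    next
      case False
      \<comment> \<open>Being a nonzero multiple of \<open>s\<close> below \<open>m + s\<close>,
        \<open>r\<close> lies between \<open>s\<close> and \<open>m\<close>; so the window contains
        all of group 2q+1.\<close>
      have "s dvd r" unfolding r_def using s(2) by (simp add: dvd_mod)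
      then have sr: "s \<le> r" using False by (simp add: dvd_imp_le)
      have "s dvd ?Q - r" using \<open>s dvd r\<close> s(2) by (simp add: dvd_diff_nat)
      then have "s \<le> ?Q - r" using r by (intro dvd_imp_le) auto
      then have rm: "r \<le> m" using r by simp
      have "q * ?Q + ?Q \<in> window s m i" using sr rm s by (simp add: window_def i_eq)
      moreover have "?c (q * ?Q + ?Q) = 2 * q + 1" using cw[of "q * ?Q + ?Q" q] s by simp
      ultimately have "2 * q + 1 < K" using i by force
      moreover have "v \<in> window s m i" if "?c v = 2 * q + 1" "v \<in> {1..n}" for v
      proof -
        have "(v - 1) div ?Q = q \<and> m \<le> (v - 1) mod ?Q"
          using path_groupD[OF that(1)] by auto
        then show ?thesis using vq[of v] that(2) sr rm by (auto simp: window_def i_eq)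
      qed
      ultimately show False by (rule hit)
    qed
  qed
  show "koszul_nonzero n Var (carrier (mpoly_ring n) \<inter> monid (path_family s m k) :: 'a mpoly set) (K - 1) {0}"
    by (rule koszul_nonzero_monid[OF mono_path_group \<open>1 \<le> K\<close> upset_path_family Ctr CU TU])
qed

lemma ideal_depth_path_ideal:
  fixes k l m n :: nat
  assumes n: "n = k * (m - l) + l" and k: "k \<ge> 1" and lm: "0 < l" "l < m" and dv: "(m - l) dvd m"
  defines "s \<equiv> m - l"
  shows "ideal_depth n (path_ideal n m l k :: 'a::field mpoly set)
    = enat (n + 1 - ((n + s) div (m + s) + n div (m + s)))"
proof -
  let ?K = "(n + s) div (m + s) + n div (m + s)"
  let ?I = "carrier (mpoly_ring n) \<inter> monid (path_family s m k) :: 'a mpoly set"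
  have s: "s > 0" "s dvd m" "m > 0" using lm dv by (auto simp: s_def)
  have ns: "n + s = k * s + m" using n lm by (simp add: s_def)
  note kz = koszul_nonzero_path[OF s ns k]
  have I: "path_ideal n m l k = ?I" using path_ideal_eq[of n k m l] n lm by (simp add: s_def)
  \<comment> \<open>The choice \<open>d = n - ?K\<close> is below \<open>n\<close> because
    \<open>?K\<close> is at least 1; the appended variable makes the length
    \<open>n + 1 - ?K\<close>.\<close>
  have "n - ?K + ?K \<le> n" "n - ?K < n" using kz(2,3) by auto
  from regular_sequence_exists[OF s ns k this, where 'a = 'a]
  obtain fs :: "'a mpoly list" where fs: "length fs = n + 1 - ?K" "set fs \<subseteq> irrelevant_ideal n"
    "regular_sequence (mpoly_ring n) (ideal_module (mpoly_ring n) ?I) fs"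
    using kz(3) by (auto simp: Suc_diff_le)
  have "length gs \<le> n + 1 - ?K"
    if "set gs \<subseteq> irrelevant_ideal n" "regular_sequence (mpoly_ring n) (ideal_module (mpoly_ring n) ?I) gs" for gs
    using regular_sequence_length_le[OF kz(1) ideal_carrier_monid[OF upset_path_family] that] kz(2) by simp
  then have "Sup {enat (length gs) | gs. set gs \<subseteq> irrelevant_ideal n \<and>
      regular_sequence (mpoly_ring n) (ideal_module (mpoly_ring n) ?I) gs} = enat (n + 1 - ?K)"
    using fs by (intro antisym Sup_least Sup_upper) (auto intro!: exI[of _ fs])
  then show ?thesis by (simp add: ideal_depth_def depth_def I)
qed

theorem corollary3p9:
  fixes k l m n :: nat
  assumes "n = k * (m - l) + l"
    and "k \<ge> 1" and "m \<ge> 2"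
    and "\<lceil>real m / 2\<rceil> \<le> int l" and "l < m"
    and "m mod (m - l) = 0"
  shows "\<exists>d::nat. ideal_depth n (path_ideal n m l k :: 'a::field mpoly set) = enat d \<and>
    int d = int n + 2
      - \<lceil>(real n + (real m - real l)) / (2 * real m - real l)\<rceil>
      - \<lfloor>(real n + (real m - real l)) / (2 * real m - real l)\<rfloor>"
proof -
  define s where "s = m - l"
  let ?Q = "m + s"
  have "0 < real m / 2" using assms(3) by simp
  then have "0 < \<lceil>real m / 2\<rceil>" by simp
  then have l: "0 < l" using assms(4) by linarith
  have dv: "s dvd m" using assms(6) by (simp add: s_def dvd_eq_mod_eq_0)
  have s: "s > 0" using assms(5) by (simp add: s_def)
  have ns: "n + s = k * s + m" using assms(1,5) by (simp add: s_def)
  have "s dvd n + s" unfolding ns using dv by simp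
  then have sn: "s dvd n" by (simp add: dvd_add_triv_right_iff)
  have num: "real n + (real m - real l) = real (n + s)" "2 * real m - real l = real ?Q"
    using assms(5) by (auto simp: s_def of_nat_diff)
  have fl: "\<lfloor>real (n + s) / real ?Q\<rfloor> = int ((n + s) div ?Q)"
    by (simp only: floor_divide_of_nat_eq)
  \<comment> \<open>Both \<open>n\<close> and \<open>m\<close> are multiples of \<open>s\<close>, so
    \<open>n mod ?Q\<close> is at most \<open>?Q - s\<close>. Adding \<open>s > 0\<close> therefore
    takes \<open>n\<close> strictly beyond \<open>(n div ?Q) * ?Q\<close> but not past the next
    multiple of \<open>?Q\<close>.\<close>
  have ce: "\<lceil>real (n + s) / real ?Q\<rceil> = int (n div ?Q) + 1"
  proof (rule ceiling_unique)
    define q r where "q = n div ?Q" and "r = n mod ?Q"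
    have nq: "n = q * ?Q + r" unfolding q_def r_def by (rule div_mult_mod_eq[symmetric])
    have r: "r < ?Q" using s by (simp add: r_def)
    have "s dvd r" unfolding r_def using dv sn by (simp add: dvd_mod)
    then have "s dvd ?Q - r" using dv by (simp add: dvd_diff_nat)
    then have "s \<le> ?Q - r" using r by (intro dvd_imp_le) auto
    then have "n + s \<le> (q + 1) * ?Q" using nq r by simp
    moreover have pos: "0 < real ?Q" using s by simp
    moreover have "real_of_int (int (n div ?Q) + 1) = real (q + 1)" by (simp add: q_def)
    ultimately show "real (n + s) / real ?Q \<le> real_of_int (int (n div ?Q) + 1)"
      by (simp only: pos_divide_le_eq of_nat_le_iff flip: of_nat_mult)
    have "q * ?Q < n + s" using nq s by simp
    moreover have "real_of_int (int (n div ?Q) + 1) - 1 = real q" by (simp add: q_def)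
    ultimately show "real_of_int (int (n div ?Q) + 1) - 1 < real (n + s) / real ?Q"
      using pos by (simp only: pos_less_divide_eq of_nat_less_iff flip: of_nat_mult)
  qed
  have K: "(n + s) div ?Q + n div ?Q \<le> n"
    using koszul_nonzero_path(3)[of s m n k] s dv ns assms(2,3) by simp
  have "ideal_depth n (path_ideal n m l k :: 'a mpoly set) = enat (n + 1 - ((n + s) div ?Q + n div ?Q))"
    using ideal_depth_path_ideal[OF assms(1,2) l assms(5)] dv unfolding s_def by blast
  moreover have "int (n + 1 - ((n + s) div ?Q + n div ?Q)) = int n + 2
      - \<lceil>real (n + s) / real ?Q\<rceil> - \<lfloor>real (n + s) / real ?Q\<rfloor>"
    unfolding fl ce using K by (simp add: of_nat_diff)
  ultimately show ?thesis unfolding num by blast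
qed

end
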